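(* Let $A\in\mathbb{R}^{n\times n}$ be skew-symmetric (hence neutrally stable, i.e. all its eigenvalues are semi-simple with zero real parts), let $C_i\in\mathbb{R}^{m_i\times n}$ for $i=1,\ldots,N$, and let $C=\mathrm{col}(C_1,\ldots,C_N)$. For each $i$ let $\nu_i=\dim\ker(\mathcal{O}_i)$, where $\mathcal{O}_i=\mathrm{col}(C_i,C_iA,\ldots,C_iA^{n-1})$, let $U_i\in\mathbb{R}^{n\times\nu_i}$ be a matrix whose columns form an orthonormal basis of $\ker(\mathcal{O}_i)$, and let $A_{i\bar o}\in\mathbb{R}^{\nu_i\times\nu_i}$ be the matrix of the unobservable part of $(C_i,A)$ defined in the context. Let $\nu=\sum_{i=1}^N\nu_i$, $U=\mathrm{block\ diag}\{U_1,\ldots,U_N\}\in\mathbb{R}^{Nn\times\nu}$, $A_{\bar o}=\mathrm{block\ diag}\{A_{1\bar o},\ldots,A_{N\bar o}\}\in\mathbb{R}^{\nu\times\nu}$, and $\Gamma=\mathrm{block\ diag}\{\gamma_1I_{\nu_1},\ldots,\gamma_NI_{\nu_N}\}\in\mathbb{R}^{\nu\times\nu}$ with $\gamma_i>0$, $i=1,\ldots,N$. Let $\mathcal{G}_{\sigma(t)}$ be an undirected switching graph on the nodes $\{1,\ldots,N\}$ with Laplacian $\mathcal{L}_{\sigma(t)}$. Assume that the pair $(C,A)$ is observable and that $\mathcal{G}_{\sigma(t)}$ is jointly connected. Then the linear switched system $$\dot\zeta(t)=\Bigl(A_{\bar o}-\Gamma U^T\bigl(\mathcal{L}_{\sigma(t)}\otimes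 I_n\bigr)U\Bigr)\zeta(t),\qquad t\ge0,$$ with state $\zeta(t)\in\mathbb{R}^\nu$, is exponentially stable.
   Context: **Notation.** $\mathrm{col}(X_1,\ldots,X_N)=[X_1^T\ \cdots\ X_N^T]^T$; $\otimes$ is the Kronecker product. Blocks of zero size are allowed. Solutions are continuous and satisfy the differential equation except at switching instants. **The matrices $A_{i\bar o}$.** Let $D_i\in\mathbb{R}^{n\times(n-\nu_i)}$ have columns forming an orthonormal basis of $\mathrm{im}(\mathcal{O}_i^T)$ and let $T_i=[D_i\ \ U_i]$, an orthogonal matrix. Then, $A$ being skew-symmetric, $T_i^TAT_i=\begin{bmatrix}A_{io}&0\\0&A_{i\bar o}\end{bmatrix}$ with $A_{io}\in\mathbb{R}^{(n-\nu_i)\times(n-\nu_i)}$ and $A_{i\bar o}\in\mathbb{R}^{\nu_i\times\nu_i}$; that is, $A_{i\bar o}=U_i^TAU_i$. **Exponential stability.** A linear time-varying system $\dot z(t)=A(t)z(t)$, $t\ge 0$, is exponentially stable if there exist $c,\lambda>0$ such that $\|z(t)\|\le ce^{-\lambda(t-t^* )}\|z(t^* )\|$ for all $t\ge t^*\ge0$ and all solutions. **Switching signal and graph.** $\sigma:[0,\infty)\to\mathcal{P}=\{1,\ldots,n_0\}$ is a piecewise constant switching signal: there is a sequence $\{t_j:j=0,1,2,\ldots\}$ (the switching instants) with $t_0=0$ and $t_{j+1}-t_j\ge\tau$ for all $j$, for some $\tau>0$ (the dwell time), such that $\sigma$ is constant on each $[t_j,t_{j+1})$. There are $n_0$ undirected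 graphs $\mathcal{G}_p=(\mathcal{V},\mathcal{E}_p)$, $p\in\mathcal{P}$, on $\mathcal{V}=\{1,\ldots,N\}$, each with a weighted adjacency matrix $\mathcal{A}_p=[a_{ij}]\in\mathbb{R}^{N\times N}$ that is symmetric, with $a_{ii}=0$ and, for $i\ne j$, $a_{ij}>0$ if $(j,i)\in\mathcal{E}_p$ and $a_{ij}=0$ otherwise. The Laplacian $\mathcal{L}_p=[l_{ij}]$ is given by $l_{ii}=\sum_{j=1}^Na_{ij}$ and $l_{ij}=-a_{ij}$ for $i\ne j$. The switching graph is $\mathcal{G}_{\sigma(t)}=(\mathcal{V},\mathcal{E}_{\sigma(t)})$, with Laplacian $\mathcal{L}_{\sigma(t)}$. **Jointly connected.** There exists a subsequence $\{t_{j_k}:k=0,1,2,\ldots\}$ of the switching instants with $t_{j_0}=0$ and $\tau\le t_{j_{k+1}}-t_{j_k}\le T_c$ for all $k$, for some $T_c>0$, such that for every $k$ the union graph $\bigcup_{t_j\in[t_{j_k},t_{j_{k+1}})}\mathcal{G}_{\sigma(t_j)}$ (node set $\mathcal{V}$, edge set the union of the edge sets) is connected. *)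

theory Defs
  imports
    Complex_Main
    "Jordan_Normal_Form.DL_Rank"
    "Jordan_Normal_Form.Matrix_Kernel"
    "Graph_Theory.Graph_Theory"
begin

text \<open>Families over the nodes \<open>1, \<dots>, N\<close> are indexed by \<open>0, \<dots>, N - 1\<close>, in accordance with the
  index range of rows and columns of a matrix. Matrices may have zero rows or columns.\<close>

subsection \<open>Block matrices and the Kronecker product\<close>

text \<open>\<open>col(X\<^sub>1, \<dots>, X\<^sub>k)\<close>; the common number \<open>n\<close> of columns is a parameter because the list may be
  empty.\<close>

definition stack_mat :: "nat \<Rightarrow> 'a mat list \<Rightarrow> 'a mat" where
  "stack_mat n Xs = mat_of_rows n (concat (map rows Xs))"

definition kronecker :: "'a :: times mat \<Rightarrow> 'a mat \<Rightarrow> 'a mat" where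
  "kronecker A B = mat (dim_row A * dim_row B) (dim_col A * dim_col B)
     (\<lambda>(i, j). A $$ (i div dim_row B, j div dim_col B) * B $$ (i mod dim_row B, j mod dim_col B))"

subsection \<open>Observability\<close>

definition observability_mat :: "real mat \<Rightarrow> real mat \<Rightarrow> real mat" where
  "observability_mat C A = stack_mat (dim_row A) (map (\<lambda>k. C * (A ^\<^sub>m k)) [0..<dim_row A])"

definition observable :: "real mat \<Rightarrow> real mat \<Rightarrow> bool" where
  "observable C A \<longleftrightarrow>
     vec_space.rank (dim_row (observability_mat C A)) (observability_mat C A) = dim_row A"

definition orthonormal_basis_cols :: "real mat \<Rightarrow> real vec set \<Rightarrow> bool" where
  "orthonormal_basis_cols U W \<longleftrightarrow>
     transpose_mat U * U = 1\<^sub>m (dim_col U) \<and> vec_space.col_space (dim_row U) U = W"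

text \<open>If the columns of \<open>D\<close> and \<open>U\<close> are orthonormal bases of the range of the transposed observability
  matrix and of the kernel of the observability matrix, and \<open>T = [D U]\<close>, then this is the lower
  right block of \<open>T\<^sup>T A T\<close>.\<close>

definition unobservable_part :: "real mat \<Rightarrow> real mat \<Rightarrow> real mat" where
  "unobservable_part A U = transpose_mat U * A * U"

subsection \<open>Linear time-varying systems\<close>

definition euclidean_norm :: "real vec \<Rightarrow> real" where
  "euclidean_norm v = sqrt (scalar_prod v v)"

text \<open>\<open>S\<close> is the set of instants at which the differential equation need not hold.\<close>

definition ltv_solution ::
  "nat \<Rightarrow> (real \<Rightarrow> real mat) \<Rightarrow> real set \<Rightarrow> (real \<Rightarrow> real vec) \<Rightarrow> bool" where
  "ltv_solution d M S z \<longleftrightarrow>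
     (\<forall>s\<ge>0. z s \<in> carrier_vec d) \<and>
     (\<forall>i<d. continuous_on {0..} (\<lambda>s. vec_index (z s) i)) \<and>
     (\<forall>s\<ge>0. s \<notin> S \<longrightarrow> (\<forall>i<d.
        ((\<lambda>r. vec_index (z r) i) has_real_derivative vec_index (M s *\<^sub>v z s) i)
          (at s within {0..})))"

definition exponentially_stable :: "nat \<Rightarrow> (real \<Rightarrow> real mat) \<Rightarrow> real set \<Rightarrow> bool" where
  "exponentially_stable d M S \<longleftrightarrow>
     (\<exists>c>0. \<exists>l>0. \<forall>z. ltv_solution d M S z \<longrightarrow>
        (\<forall>s0\<ge>0. \<forall>s\<ge>s0. euclidean_norm (z s) \<le> c * exp (- l * (s - s0)) * euclidean_norm (z s0)))"

subsection \<open>Switching graphs\<close>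

text \<open>An undirected graph is a symmetric digraph. Loops are not excluded; they affect neither the
  Laplacian nor connectedness.\<close>

definition undirected_graph_on :: "nat \<Rightarrow> nat pair_pre_digraph \<Rightarrow> bool" where
  "undirected_graph_on N G \<longleftrightarrow> pair_pseudo_graph G \<and> pverts G = {0..<N}"

definition weighted_adjacency :: "nat \<Rightarrow> nat pair_pre_digraph \<Rightarrow> real mat \<Rightarrow> bool" where
  "weighted_adjacency N G W \<longleftrightarrow>
     W \<in> carrier_mat N N \<and> transpose_mat W = W \<and>
     (\<forall>i<N. W $$ (i, i) = 0) \<and>
     (\<forall>i<N. \<forall>j<N. i \<noteq> j \<longrightarrow>
        (if (j, i) \<in> parcs G then W $$ (i, j) > 0 else W $$ (i, j) = 0))"

definition laplacian :: "real mat \<Rightarrow> real mat" where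
  "laplacian W = mat (dim_row W) (dim_row W)
     (\<lambda>(i, j). if i = j then (\<Sum>k<dim_row W. W $$ (i, k)) else - W $$ (i, j))"

definition switching_signal ::
  "nat \<Rightarrow> real \<Rightarrow> (nat \<Rightarrow> real) \<Rightarrow> (real \<Rightarrow> nat) \<Rightarrow> bool" where
  "switching_signal n0 \<tau> t \<sigma> \<longleftrightarrow>
     \<tau> > 0 \<and> t 0 = 0 \<and> (\<forall>j. t (Suc j) - t j \<ge> \<tau>) \<and>
     (\<forall>s\<ge>0. \<sigma> s \<in> {1..n0}) \<and>
     (\<forall>j. \<forall>s\<in>{t j..<t (Suc j)}. \<sigma> s = \<sigma> (t j))"

definition union_graph ::
  "nat \<Rightarrow> (nat \<Rightarrow> nat pair_pre_digraph) \<Rightarrow> (nat \<Rightarrow> real) \<Rightarrow> (real \<Rightarrow> nat) \<Rightarrow> real \<Rightarrow> real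
     \<Rightarrow> nat pair_pre_digraph" where
  "union_graph N G t \<sigma> a b =
     \<lparr> pverts = {0..<N}, parcs = (\<Union>j\<in>{j. t j \<in> {a..<b}}. parcs (G (\<sigma> (t j)))) \<rparr>"

definition jointly_connected ::
  "nat \<Rightarrow> (nat \<Rightarrow> nat pair_pre_digraph) \<Rightarrow> real \<Rightarrow> (nat \<Rightarrow> real) \<Rightarrow> (real \<Rightarrow> nat) \<Rightarrow> bool" where
  "jointly_connected N G \<tau> t \<sigma> \<longleftrightarrow>
     (\<exists>q :: nat \<Rightarrow> nat. \<exists>Tc>0. strict_mono q \<and> t (q 0) = 0 \<and>
        (\<forall>k. \<tau> \<le> t (q (Suc k)) - t (q k) \<and> t (q (Suc k)) - t (q k) \<le> Tc \<and>
             Digraph_Component.connected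
               (with_proj (union_graph N G t \<sigma> (t (q k)) (t (q (Suc k)))))))"

end

theory Submission
  imports Defs "HOL-Analysis.L2_Norm"
begin

text \<open>
  Put \<open>x\<^sub>i = U\<^sub>i \<zeta>\<^sub>i\<close> and \<open>P\<^sub>i = U\<^sub>i U\<^sub>i\<^sup>T\<close>. Then \<open>x\<^sub>i\<close> is a vector of \<open>\<real>\<^sup>n\<close> in the unobservable
  subspace of \<open>(C\<^sub>i, A)\<close>, and \<open>P\<^sub>i\<close> is the orthogonal projection onto that subspace. The subspace is
  invariant under \<open>A\<close> (\<open>unobservable_subspace_invariant\<close>), so that \<open>U\<^sub>i U\<^sub>i\<^sup>T A U\<^sub>i = A U\<^sub>i\<close> and the system
  reads
    \<open>x\<^sub>i' = A x\<^sub>i - \<gamma>\<^sub>i P\<^sub>i (\<Sum>j. w\<^sub>i\<^sub>j (x\<^sub>i - x\<^sub>j))\<close>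
  with the edge weights \<open>w\<^sub>i\<^sub>j\<close> of the active graph (\<open>network_matrix_in_node_coordinates\<close>). No length is
  lost: \<open>\<Sum>i. |x\<^sub>i|\<^sup>2 = |\<zeta>|\<^sup>2\<close>.

  The energy \<open>V = \<Sum>i. |x\<^sub>i|\<^sup>2 / \<gamma>\<^sub>i\<close> has derivative \<open>- g\<close>, where \<open>g = \<Sum>i j. w\<^sub>i\<^sub>j |x\<^sub>i - x\<^sub>j|\<^sup>2\<close>
  (\<open>energy_rate\<close>): the skew-symmetric drift contributes nothing, and \<open>P\<^sub>i\<close> disappears because it is
  symmetric and fixes \<open>x\<^sub>i\<close>. At a single instant \<open>g\<close> may vanish without \<open>V\<close> vanishing. The point is that
  over a window \<open>[a, b]\<close> whose union graph is connected the dissipated energy \<open>\<delta> = V a - V b\<close>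
  bounds \<open>V a\<close> itself, up to a constant that is the same for all windows and all solutions:

  \<^item> The drift does not change \<open>|x\<^sub>i - x\<^sub>j|\<close>, and the coupling terms are bounded by a multiple of
    \<open>sqrt g\<close>. So \<open>|x\<^sub>i - x\<^sub>j|\<^sup>2\<close> at time \<open>a\<close> is at most a constant times its value at any
    later instant of the window plus a multiple of \<open>\<delta>\<close> (\<open>node_dist_rate\<close>, \<open>disagreement_bound\<close>).
    Skew-symmetry thus takes the place of a passage to the rotating coordinates \<open>exp (- A t) x\<^sub>i\<close>.
  \<^item> An edge of the union graph is active on an interval of length at least the dwell time. Somewhere in it
    \<open>g\<close> is at most \<open>\<delta> / \<tau>\<close> (\<open>small_dissipation_instant\<close>), so \<open>|x\<^sub>i - x\<^sub>j|\<^sup>2\<close> is at most a multiple of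
    \<open>\<delta>\<close> there, and
    by the first item also at time \<open>a\<close>. Connectedness extends the bound to all pairs of nodes
    (\<open>dissipation_over_connected_window\<close>).
  \<^item> By joint observability, only \<open>0\<close> is unobservable at every node. Quantitatively, \<open>|y|\<^sup>2\<close> is at most a
    multiple of \<open>\<Sum>i. |y - P\<^sub>i y|\<^sup>2\<close> (\<open>distance_to_fixed_spaces\<close>). For \<open>y = x\<^sub>j\<close> the right-hand side is
    bounded by the distances \<open>|x\<^sub>i - x\<^sub>j|\<^sup>2\<close>, as \<open>x\<^sub>i = P\<^sub>i x\<^sub>i\<close> (\<open>energy_le_node_dist\<close>).

  Hence \<open>V b \<le> \<rho> V a\<close> with a uniform \<open>\<rho> < 1\<close>. Since \<open>V\<close> never increases and the windows have bounded
  length, this contraction gives the exponential rate (\<open>exponential_decay_of_window_contraction\<close>).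
\<close>

section \<open>Decay of an energy dissipated over jointly connected windows\<close>

text \<open>A solution need not be differentiable at switching instants; continuity carries the monotonicity
  across each of them.\<close>

lemma nondecreasing_off_finite:
  fixes f :: "real \<Rightarrow> real"
  assumes "finite S" "a \<le> b" "continuous_on {a..b} f"
    and "\<And>x. a < x \<Longrightarrow> x < b \<Longrightarrow> x \<notin> S \<Longrightarrow> \<exists>y. (f has_real_derivative y) (at x) \<and> 0 \<le> y"
  shows "f a \<le> f b"
  using assms
proof (induction S arbitrary: a b rule: finite_induct)
  case empty
  show ?case
    by (rule DERIV_nonneg_imp_increasing_open) (use empty in auto)
next
  case (insert c S)
  show ?case
  proof (cases "a < c \<and> c < b")
    case True
    have "f a \<le> f c"
      using True insert.prems
      by (intro insert.IH) (auto intro: continuous_on_subset)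
    moreover have "f c \<le> f b"
      using True insert.prems
      by (intro insert.IH) (auto intro: continuous_on_subset)
    ultimately show ?thesis by simp
  next
    case False
    then show ?thesis
      using insert.prems by (intro insert.IH) auto
  qed
qed

text \<open>The factor \<open>1 / \<rho>\<close> pays for the last, incomplete period: the number of completed periods is only known
  to exceed \<open>(s - r) / L - 1\<close>.\<close>

lemma exponential_decay_of_periodic_contraction:
  fixes V :: "real \<Rightarrow> real"
  assumes nonneg: "\<And>s. s \<ge> 0 \<Longrightarrow> V s \<ge> 0"
    and antimono: "\<And>r s. 0 \<le> r \<Longrightarrow> r \<le> s \<Longrightarrow> V s \<le> V r"
    and "L > 0" "0 < \<rho>" "\<rho> < 1"
    and contraction: "\<And>s. s \<ge> 0 \<Longrightarrow> V (s + L) \<le> \<rho> * V s"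
    and "0 \<le> r" "r \<le> s"
  shows "V s \<le> 1 / \<rho> * exp (ln \<rho> / L * (s - r)) * V r"
proof -
  define k where "k = nat \<lfloor>(s - r) / L\<rfloor>"
  have pos: "0 \<le> (s - r) / L" using assms by simp
  have k: "real k \<le> (s - r) / L" "(s - r) / L - 1 \<le> real k"
    using pos unfolding k_def by (simp, linarith)
  have iter: "V (r + real j * L) \<le> \<rho> ^ j * V r" for j
  proof (induction j)
    case (Suc j)
    have "V (r + real (Suc j) * L) = V ((r + real j * L) + L)"
      by (simp add: algebra_simps)
    also have "\<dots> \<le> \<rho> * V (r + real j * L)"
      using assms by (intro contraction) simp
    also have "\<dots> \<le> \<rho> * (\<rho> ^ j * V r)"
      using Suc assms by simp
    finally show ?case by simp
  qed simp
  have "V s \<le> V (r + real k * L)"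
    using k assms by (intro antimono) (auto simp: field_simps)
  also have "\<dots> \<le> \<rho> ^ k * V r" by (rule iter)
  also have "\<rho> ^ k = exp (real k * ln \<rho>)"
    using assms by (simp add: exp_of_nat_mult)
  also have "\<dots> \<le> exp (((s - r) / L - 1) * ln \<rho>)"
    using k assms by (simp add: mult_right_mono_neg)
  also have "\<dots> = 1 / \<rho> * exp (ln \<rho> / L * (s - r))"
    using assms by (simp add: exp_diff exp_add algebra_simps diff_divide_distrib)
  finally show ?thesis
    using nonneg[of r] assms by (simp add: mult_right_mono)
qed

text \<open>The hypothesis \<open>D' \<ge> - (D + K g)\<close> says that \<open>D\<close> cannot drop much unless \<open>V\<close> does, because \<open>g\<close> is the rate at
  which \<open>V\<close> is lost. The integrating factor \<open>exp (s - a)\<close> removes the term \<open>D\<close>, and subtracting a multiple of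
  \<open>V\<close> removes the term \<open>K g\<close>; what remains is nondecreasing.\<close>

lemma disagreement_bound:
  fixes V D g :: "real \<Rightarrow> real"
  assumes fin: "finite S" and ab: "a \<le> c" "c \<le> b" "b - a \<le> T" and "0 \<le> K"
    and cont: "continuous_on {a..b} V" "continuous_on {a..b} D"
    and dV: "\<And>s. a < s \<Longrightarrow> s < b \<Longrightarrow> s \<notin> S \<Longrightarrow> (V has_real_derivative - g s) (at s)"
    and g: "\<And>s. a < s \<Longrightarrow> s < b \<Longrightarrow> s \<notin> S \<Longrightarrow> 0 \<le> g s"
    and dD: "\<And>s. a < s \<Longrightarrow> s < b \<Longrightarrow> s \<notin> S \<Longrightarrow>
      \<exists>y. (D has_real_derivative y) (at s) \<and> - (D s + K * g s) \<le> y"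
    and "0 \<le> D c"
  shows "D a \<le> exp T * (D c + K * (V a - V c))"
proof -
  (* On the window, exp (s - a) is at most exp T, so the constant exp T * K absorbs the variable
     factor exp (s - a) * K of the dissipation rate. *)
  define f where "f s = exp (s - a) * D s - exp T * K * V s" for s
  have "f a \<le> f c"
  proof (rule nondecreasing_off_finite[OF fin ab(1)])
    show "continuous_on {a..c} f"
      unfolding f_def using ab
      by (intro continuous_intros continuous_on_subset[OF cont(1)] continuous_on_subset[OF cont(2)]) auto
  next
    fix x assume x: "a < x" "x < c" "x \<notin> S"
    then have xb: "x < b" using ab by simp
    obtain y where y: "(D has_real_derivative y) (at x)" "- (D x + K * g x) \<le> y"
      using dD[OF x(1) xb x(3)] by blast
    have "(f has_real_derivative
        (exp (x - a) * D x + exp (x - a) * y - exp T * K * (- g x))) (at x)"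
      unfolding f_def
      by (rule derivative_eq_intros y dV x xb refl | simp)+
    moreover have "0 \<le> exp (x - a) * D x + exp (x - a) * y - exp T * K * (- g x)"
    proof -
      have "exp (x - a) * (- (K * g x)) \<le> exp (x - a) * (D x + y)"
        using y by (intro mult_left_mono) auto
      moreover have "exp (x - a) * (K * g x) \<le> exp T * (K * g x)"
        using g[OF x(1) xb x(3)] \<open>0 \<le> K\<close> x xb ab by (intro mult_right_mono) auto
      ultimately show ?thesis by (simp add: algebra_simps)
    qed
    ultimately show "\<exists>y. (f has_real_derivative y) (at x) \<and> 0 \<le> y" by blast
  qed
  then have "D a \<le> exp (c - a) * D c + exp T * K * (V a - V c)"
    unfolding f_def by (simp add: algebra_simps)
  also have "\<dots> \<le> exp T * D c + exp T * K * (V a - V c)"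
    using ab \<open>0 \<le> D c\<close> by (intro add_right_mono mult_right_mono) auto
  finally show ?thesis by (simp add: algebra_simps)
qed

text \<open>A mean value argument: if \<open>g\<close> exceeded \<open>(V u - V v) / \<tau>\<close> on the whole interval, more energy than
  \<open>V u - V v\<close> would be lost on it.\<close>

lemma small_dissipation_instant:
  fixes V g :: "real \<Rightarrow> real"
  assumes "0 < \<tau>" "\<tau> \<le> v - u" and cont: "continuous_on {u..v} V"
    and dV: "\<And>s. u < s \<Longrightarrow> s < v \<Longrightarrow> (V has_real_derivative - g s) (at s)"
    and g: "\<And>s. u < s \<Longrightarrow> s < v \<Longrightarrow> 0 \<le> g s"
  obtains s where "u < s" "s < v" "\<tau> * g s \<le> V u - V v"
proof -
  have "u < v" using assms by simp
  have "\<exists>l z. u < z \<and> z < v \<and> DERIV V z :> l \<and> V v - V u = (v - u) * l"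
    by (rule MVT[OF \<open>u < v\<close> cont]) (use dV real_differentiable_def in blast)
  then obtain l z where z: "u < z" "z < v" "DERIV V z :> l" "V v - V u = (v - u) * l" by blast
  have "l = - g z" using DERIV_unique[OF z(3) dV] z by simp
  then have "(v - u) * g z = V u - V v" using z by (simp add: algebra_simps)
  moreover have "\<tau> * g z \<le> (v - u) * g z" using assms g z by (intro mult_right_mono) auto
  ultimately show thesis using that z by simp
qed

text \<open>The hypothesis on triples is what the triangle inequality becomes for squared distances. Each further
  edge of a path costs at most a factor \<open>4\<close>, and a reachable point is reached in at most \<open>card R\<close> steps.\<close>

lemma chained_disagreement:
  fixes D :: "'a \<Rightarrow> 'a \<Rightarrow> real"
  assumes "\<And>i. D i i = 0" and tri: "\<And>i j k. D i k \<le> 2 * D i j + 2 * D j k"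
    and R: "\<And>i j. (i, j) \<in> R \<Longrightarrow> D i j \<le> r" and "0 \<le> r"
    and "finite R" "card R \<le> M" and ij: "(i, j) \<in> R\<^sup>*"
  shows "D i j \<le> 4 ^ M * r"
proof -
  have step: "(i, j) \<in> R ^^ k \<Longrightarrow> D i j \<le> 4 ^ k * r" for k j
  proof (induction k arbitrary: j)
    case 0
    then show ?case using assms by simp
  next
    case (Suc k)
    then obtain l where l: "(i, l) \<in> R ^^ k" "(l, j) \<in> R" by auto
    have "D i j \<le> 2 * D i l + 2 * D l j" by (rule tri)
    also have "\<dots> \<le> 2 * (4 ^ k * r) + 2 * (4 ^ k * r)"
    proof -
      have "D l j \<le> 1 * r" using R l by simp
      also have "\<dots> \<le> 4 ^ k * r" using \<open>0 \<le> r\<close> by (intro mult_right_mono) auto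
      finally show ?thesis using Suc.IH[OF l(1)] by (intro add_mono) auto
    qed
    finally show ?case by (simp add: algebra_simps)
  qed
  obtain k where k: "k \<le> card R" "(i, j) \<in> R ^^ k"
    using ij unfolding rtrancl_finite_eq_relpow[OF \<open>finite R\<close>] by auto
  have "D i j \<le> 4 ^ k * r" by (rule step[OF k(2)])
  also have "\<dots> \<le> 4 ^ M * r"
    using k assms by (intro mult_right_mono power_increasing) auto
  finally show ?thesis .
qed

text \<open>The dwell time keeps the switching instants apart, so every bounded stretch of time contains finitely many.\<close>

lemma switching_instants:
  assumes "switching_signal n0 \<tau> t \<sigma>"
  shows switching_instants_strict_mono: "strict_mono t"
    and switching_instants_nonneg: "0 \<le> t j"
    and finite_switching_instants: "finite (range t \<inter> {..b})"
    and signal_at_instant: "t l < s \<Longrightarrow> s < t (Suc l) \<Longrightarrow> \<sigma> s = \<sigma> (t l)"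
    and no_instant_between: "t l < s \<Longrightarrow> s < t (Suc l) \<Longrightarrow> s \<notin> range t"
proof -
  note sw = assms[unfolded switching_signal_def]
  have gap: "t j + \<tau> \<le> t (Suc j)" for j using sw by (simp add: algebra_simps)
  have "0 < \<tau>" using sw by simp
  show mono: "strict_mono t"
    unfolding strict_mono_Suc_iff using gap \<open>0 < \<tau>\<close> by (metis add_less_same_cancel1 less_add_same_cancel1 order_less_le_trans)
  have lower: "real j * \<tau> \<le> t j" for j
  proof (induction j)
    case (Suc j)
    then show ?case using gap[of j] by (simp add: algebra_simps)
  qed (use sw in simp)
  show "0 \<le> t j" by (rule order_trans[OF _ lower]) (use \<open>0 < \<tau>\<close> in simp)
  have "range t \<inter> {..b} \<subseteq> t ` {..nat \<lceil>b / \<tau>\<rceil>}"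
  proof
    fix s assume "s \<in> range t \<inter> {..b}"
    then obtain j where j: "s = t j" "t j \<le> b" by auto
    have "real j * \<tau> \<le> b" using lower[of j] j by simp
    then have "real j \<le> b / \<tau>" using \<open>0 < \<tau>\<close> by (simp add: field_simps)
    then have "j \<le> nat \<lceil>b / \<tau>\<rceil>" by linarith
    then show "s \<in> t ` {..nat \<lceil>b / \<tau>\<rceil>}" using j by auto
  qed
  then show "finite (range t \<inter> {..b})" by (rule finite_subset) simp
  show "t l < s \<Longrightarrow> s < t (Suc l) \<Longrightarrow> \<sigma> s = \<sigma> (t l)" using sw by auto
  show "t l < s \<Longrightarrow> s < t (Suc l) \<Longrightarrow> s \<notin> range t"
    using mono by (auto simp: strict_mono_less)
qed

text \<open>Connectedness is defined by walks in the symmetric closure of the digraph, which is why both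
  orientations of every arc occur.\<close>

lemma connected_imp_rtrancl:
  assumes "Digraph_Component.connected (with_proj H)" "i \<in> pverts H" "j \<in> pverts H"
  shows "(i, j) \<in> (parcs H \<union> (parcs H)\<inverse>)\<^sup>*"
proof -
  have "(i, j) \<in> rtrancl_on (pverts H) (parcs (mk_symmetric (with_proj H)))"
    using assms by (auto simp: connected_def strongly_connected_def reachable_def)
  then have "(i, j) \<in> (parcs (mk_symmetric (with_proj H)))\<^sup>*"
    by (induction rule: rtrancl_on_induct) (auto intro: rtrancl_into_rtrancl)
  moreover have "parcs (mk_symmetric (with_proj H)) = parcs H \<union> (parcs H)\<inverse>"
    by (auto simp: parcs_mk_symmetric)
  ultimately show ?thesis by simp
qed

lemma dissipated_energy_antimono:
  fixes V g :: "real \<Rightarrow> real"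
  assumes sw: "switching_signal n0 \<tau> t \<sigma>"
    and contV: "continuous_on {0..} V"
    and dV: "\<And>s. 0 < s \<Longrightarrow> s \<notin> range t \<Longrightarrow> (V has_real_derivative - g s) (at s)"
    and g: "\<And>s. 0 < s \<Longrightarrow> s \<notin> range t \<Longrightarrow> 0 \<le> g s"
    and uv: "0 \<le> u" "u \<le> v"
  shows "V v \<le> V u"
proof -
  have "- V u \<le> - V v"
  proof (rule nondecreasing_off_finite[OF finite_switching_instants[OF sw, of v] uv(2)])
    show "continuous_on {u..v} (\<lambda>s. - V s)"
      using uv by (intro continuous_intros continuous_on_subset[OF contV]) auto
  next
    fix x assume x: "u < x" "x < v" "x \<notin> range t \<inter> {..v}"
    then have *: "0 < x" "x \<notin> range t" using uv by auto
    have "((\<lambda>s. - V s) has_real_derivative g x) (at x)"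
      using DERIV_minus[OF dV[OF *]] by simp
    then show "\<exists>y. ((\<lambda>s. - V s) has_real_derivative y) (at x) \<and> 0 \<le> y" using g[OF *] by blast
  qed
  then show ?thesis by simp
qed

text \<open>Joint connectedness enters here. Each edge of the union graph is active on a full interval between
  consecutive switching instants inside the window, so at some instant of that interval the disagreement
  across this edge is controlled by the energy lost over the window. The edges are active at different times;
  the bound on the decrease of \<open>D\<close> brings all these estimates back to the common instant \<open>t p\<close>, where they
  can be chained along paths.\<close>

lemma dissipation_over_connected_window:
  fixes V g :: "real \<Rightarrow> real" and D :: "nat \<Rightarrow> nat \<Rightarrow> real \<Rightarrow> real"
  assumes sw: "switching_signal n0 \<tau> t \<sigma>"
    and window: "t p \<le> t q" "t q - t p \<le> T"
    and conn: "Digraph_Component.connected (with_proj (union_graph N G t \<sigma> (t p) (t q)))"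
    and arcs: "\<And>l i j. (i, j) \<in> parcs (G (\<sigma> (t l))) \<Longrightarrow> i < N \<and> j < N"
    and contV: "continuous_on {0..} V"
    and dV: "\<And>s. 0 < s \<Longrightarrow> s \<notin> range t \<Longrightarrow> (V has_real_derivative - g s) (at s)"
    and contD: "\<And>i j. i < N \<Longrightarrow> j < N \<Longrightarrow> continuous_on {0..} (D i j)"
    and dD: "\<And>i j s. i < N \<Longrightarrow> j < N \<Longrightarrow> 0 < s \<Longrightarrow> s \<notin> range t \<Longrightarrow>
      \<exists>y. (D i j has_real_derivative y) (at s) \<and> - (D i j s + K * g s) \<le> y"
    and g: "\<And>s. 0 < s \<Longrightarrow> s \<notin> range t \<Longrightarrow> 0 \<le> g s"
    and edge: "\<And>i j s. (i, j) \<in> parcs (G (\<sigma> s)) \<Longrightarrow> 0 < s \<Longrightarrow> s \<notin> range t \<Longrightarrow> \<omega> * D i j s \<le> g s"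
    and D: "\<And>i j s. 0 \<le> D i j s" "\<And>i s. D i i s = 0" "\<And>i j s. D i j s = D j i s"
      "\<And>i j k s. D i k s \<le> 2 * D i j s + 2 * D j k s"
    and "0 \<le> K" "0 < \<omega>"
    and ij: "i < N" "j < N"
  shows "D i j (t p) \<le> 4 ^ (N * N) * (exp T * (1 / (\<tau> * \<omega>) + K) * (V (t p) - V (t q)))"
proof -
  have "0 < \<tau>" using sw by (simp add: switching_signal_def)
  note mono = switching_instants_strict_mono[OF sw]
  note fin = finite_switching_instants[OF sw]
  have t0: "0 \<le> t l" for l by (rule switching_instants_nonneg[OF sw])
  have V_antimono: "V v \<le> V u" if "0 \<le> u" "u \<le> v" for u v
    by (rule dissipated_energy_antimono[OF sw contV dV g that])
  define \<delta> where "\<delta> = V (t p) - V (t q)"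
  have \<delta>: "0 \<le> \<delta>" using V_antimono[OF t0 window(1)] by (simp add: \<delta>_def)
  define U where "U = parcs (union_graph N G t \<sigma> (t p) (t q))"
  have U: "D i j (t p) \<le> exp T * (1 / (\<tau> * \<omega>) + K) * \<delta>" if arc: "(i, j) \<in> U" for i j
  proof -
    obtain l where l: "t p \<le> t l" "t l < t q" "(i, j) \<in> parcs (G (\<sigma> (t l)))"
      using arc by (auto simp: U_def union_graph_def)
    have ijN: "i < N" "j < N" using arcs[OF l(3)] by auto
    have lq: "t (Suc l) \<le> t q" using l mono by (simp add: strict_mono_less strict_mono_less_eq)
    have inside: "0 < s \<and> s \<notin> range t" if "t l < s" "s < t (Suc l)" for s
      using no_instant_between[OF sw that] that t0[of l] by auto
    obtain s where s: "t l < s" "s < t (Suc l)" "\<tau> * g s \<le> V (t l) - V (t (Suc l))"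
    proof (rule small_dissipation_instant[of \<tau> "t (Suc l)" "t l" V g])
      show "\<tau> \<le> t (Suc l) - t l" using sw by (simp add: switching_signal_def)
      show "continuous_on {t l..t (Suc l)} V"
        using t0[of l] by (intro continuous_on_subset[OF contV]) auto
    qed (use \<open>0 < \<tau>\<close> inside dV g in auto)
    have "(i, j) \<in> parcs (G (\<sigma> s))" using l(3) signal_at_instant[OF sw s(1,2)] by simp
    then have "\<omega> * D i j s \<le> g s" using edge inside[OF s(1,2)] by blast
    then have "\<tau> * (\<omega> * D i j s) \<le> \<tau> * g s" using \<open>0 < \<tau>\<close> by (intro mult_left_mono) auto
    also have "\<dots> \<le> \<delta>"
      using s V_antimono[of "t p" "t l"] V_antimono[of "t (Suc l)" "t q"] l lq t0
      by (simp add: \<delta>_def)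
    finally have Ds: "D i j s \<le> 1 / (\<tau> * \<omega>) * \<delta>"
      using \<open>0 < \<tau>\<close> \<open>0 < \<omega>\<close> by (simp add: field_simps)
    have sin: "t p \<le> s" "s \<le> t q" using s l lq by auto
    have "D i j (t p) \<le> exp T * (D i j s + K * (V (t p) - V s))"
    proof (rule disagreement_bound[where g = g, OF fin[of "t q"] sin window(2) \<open>0 \<le> K\<close>])
      show "continuous_on {t p..t q} V" "continuous_on {t p..t q} (D i j)"
        using t0[of p] by (auto intro: continuous_on_subset[OF contV] continuous_on_subset[OF contD[OF ijN]])
    qed (use t0[of p] dV g dD[OF ijN] D(1) in \<open>auto simp: order_le_less_trans\<close>)
    also have "\<dots> \<le> exp T * (1 / (\<tau> * \<omega>) * \<delta> + K * \<delta>)"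
      using Ds V_antimono[of s "t q"] sin t0[of p] \<open>0 \<le> K\<close>
      by (intro mult_left_mono add_mono) (auto simp: \<delta>_def)
    finally show ?thesis by (simp add: algebra_simps)
  qed
  have UN: "U \<union> U\<inverse> \<subseteq> {..<N} \<times> {..<N}"
    using arcs by (auto simp: U_def union_graph_def)
  show ?thesis
    unfolding \<delta>_def[symmetric]
  proof (rule chained_disagreement[where R = "U \<union> U\<inverse>" and D = "\<lambda>i j. D i j (t p)"])
    show "finite (U \<union> U\<inverse>)" using UN by (rule finite_subset) simp
    show "card (U \<union> U\<inverse>) \<le> N * N" using card_mono[OF _ UN] by (simp add: card_cartesian_product)
    show "(i, j) \<in> (U \<union> U\<inverse>)\<^sup>*"
      unfolding U_def by (rule connected_imp_rtrancl[OF conn]) (use ij in \<open>auto simp: union_graph_def\<close>)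
    show "0 \<le> exp T * (1 / (\<tau> * \<omega>) + K) * \<delta>" using \<delta> \<open>0 < \<tau>\<close> \<open>0 < \<omega>\<close> \<open>0 \<le> K\<close> by simp
    fix i j assume "(i, j) \<in> U \<union> U\<inverse>"
    then show "D i j (t p) \<le> exp T * (1 / (\<tau> * \<omega>) + K) * \<delta>" using U D(3) by fastforce
  qed (rule D(2) D(4))+
qed

text \<open>Every interval of length \<open>2 * T\<close> contains a complete window, wherever it begins: a window starts within
  \<open>T\<close> and lasts at most \<open>T\<close>. This turns contraction over the given windows into contraction over a fixed
  period.\<close>

lemma exponential_decay_of_window_contraction:
  fixes V :: "real \<Rightarrow> real" and u :: "nat \<Rightarrow> real"
  assumes nonneg: "\<And>s. s \<ge> 0 \<Longrightarrow> V s \<ge> 0"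
    and antimono: "\<And>r s. 0 \<le> r \<Longrightarrow> r \<le> s \<Longrightarrow> V s \<le> V r"
    and u: "u 0 = 0" "0 < \<tau>" "\<And>k. \<tau> \<le> u (Suc k) - u k" "\<And>k. u (Suc k) - u k \<le> T"
    and contraction: "\<And>k. V (u (Suc k)) \<le> \<rho> * V (u k)"
    and \<rho>: "0 < \<rho>" "\<rho> < 1"
    and rs: "0 \<le> r" "r \<le> s"
  shows "V s \<le> 1 / \<rho> * exp (ln \<rho> / (2 * T) * (s - r)) * V r"
proof (rule exponential_decay_of_periodic_contraction[OF nonneg antimono])
  have "0 < T" using u(2) u(3)[of 0] u(4)[of 0] by linarith
  then show "0 < 2 * T" by simp
  have lower: "real k * \<tau> \<le> u k" for k
  proof (induction k)
    case (Suc k)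
    then show ?case using u(3)[of k] by (simp add: algebra_simps)
  qed (use u in simp)
  fix r :: real assume "0 \<le> r"
  have "\<exists>k. r \<le> u k"
  proof -
    obtain k :: nat where "r / \<tau> < real k" using reals_Archimedean2 by blast
    then have "r \<le> u k" using lower[of k] \<open>0 < \<tau>\<close> by (simp add: field_simps)
    then show ?thesis by blast
  qed
  define k where "k = (LEAST k. r \<le> u k)"
  have k: "r \<le> u k" unfolding k_def using \<open>\<exists>k. r \<le> u k\<close> by (rule LeastI_ex)
  have uk: "u k \<le> r + T"
  proof (cases k)
    case 0
    then show ?thesis using u \<open>0 \<le> r\<close> \<open>0 < T\<close> by simp
  next
    case (Suc l)
    then have "\<not> r \<le> u l" unfolding k_def by (metis k_def lessI not_less_Least)
    then show ?thesis using u(4)[of l] Suc by simp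
  qed
  have "V (r + 2 * T) \<le> V (u (Suc k))"
    using k uk u(3)[of k] u(4)[of k] \<open>0 \<le> r\<close> \<open>0 < \<tau>\<close> by (intro antimono) auto
  also have "\<dots> \<le> \<rho> * V (u k)" by (rule contraction)
  also have "\<dots> \<le> \<rho> * V r" using k \<open>0 \<le> r\<close> \<rho> by (intro mult_left_mono antimono) auto
  finally show "V (r + 2 * T) \<le> \<rho> * V r" .
qed (use \<rho> rs in auto)

section \<open>Energy balance of projected diffusive coupling\<close>

lemma sum_mult_power2_le:
  fixes f g :: "'a \<Rightarrow> real"
  shows "(\<Sum>i\<in>S. f i * g i)\<^sup>2 \<le> (\<Sum>i\<in>S. (f i)\<^sup>2) * (\<Sum>i\<in>S. (g i)\<^sup>2)"
proof -
  have "\<bar>\<Sum>i\<in>S. f i * g i\<bar> \<le> (\<Sum>i\<in>S. \<bar>f i\<bar> * \<bar>g i\<bar>)"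
    by (rule order_trans[OF sum_abs]) (simp add: abs_mult)
  also have "\<dots> \<le> L2_set f S * L2_set g S" by (rule L2_set_mult_ineq)
  finally have "\<bar>\<Sum>i\<in>S. f i * g i\<bar>\<^sup>2 \<le> (L2_set f S * L2_set g S)\<^sup>2"
    by (intro power_mono) auto
  then show ?thesis
    by (simp add: power_mult_distrib L2_set_def sum_nonneg)
qed

lemma sum_diff_power2_le:
  fixes f g h :: "'a \<Rightarrow> real"
  shows "(\<Sum>a\<in>S. (f a - h a)\<^sup>2) \<le> 2 * (\<Sum>a\<in>S. (f a - g a)\<^sup>2) + 2 * (\<Sum>a\<in>S. (g a - h a)\<^sup>2)"
proof -
  have "(f a - h a)\<^sup>2 \<le> 2 * (f a - g a)\<^sup>2 + 2 * (g a - h a)\<^sup>2" for a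
    using zero_le_power2[of "(f a - g a) - (g a - h a)"] by (simp add: power2_eq_square algebra_simps)
  then show ?thesis
    unfolding sum_distrib_left sum.distrib[symmetric] by (intro sum_mono)
qed

text \<open>Any bound for the operator norm would serve; the Frobenius norm is an explicit one.\<close>

lemma frobenius_bound:
  fixes P :: "'a \<Rightarrow> 'a \<Rightarrow> real"
  shows "(\<Sum>a\<in>S. (\<Sum>b\<in>S. P a b * y b)\<^sup>2) \<le> (\<Sum>a\<in>S. \<Sum>b\<in>S. (P a b)\<^sup>2) * (\<Sum>b\<in>S. (y b)\<^sup>2)"
proof -
  have "(\<Sum>a\<in>S. (\<Sum>b\<in>S. P a b * y b)\<^sup>2) \<le> (\<Sum>a\<in>S. (\<Sum>b\<in>S. (P a b)\<^sup>2) * (\<Sum>b\<in>S. (y b)\<^sup>2))"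
    by (intro sum_mono sum_mult_power2_le)
  then show ?thesis by (simp only: sum_distrib_right)
qed

lemma skew_form_zero:
  fixes A :: "'a \<Rightarrow> 'a \<Rightarrow> real"
  assumes "\<And>a b. a \<in> S \<Longrightarrow> b \<in> S \<Longrightarrow> A b a = - A a b"
  shows "(\<Sum>a\<in>S. y a * (\<Sum>b\<in>S. A a b * y b)) = 0"
proof -
  have "(\<Sum>a\<in>S. y a * (\<Sum>b\<in>S. A a b * y b)) = (\<Sum>a\<in>S. \<Sum>b\<in>S. A a b * y a * y b)"
    by (simp add: sum_distrib_left mult_ac)
  also have "\<dots> = (\<Sum>a\<in>S. \<Sum>b\<in>S. A b a * y a * y b)"
    by (subst sum.swap) (simp add: mult_ac)
  also have "\<dots> = - (\<Sum>a\<in>S. \<Sum>b\<in>S. A a b * y a * y b)"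
  proof -
    have "A b a * y a * y b = - (A a b * y a * y b)" if "a \<in> S" "b \<in> S" for a b
      using assms[OF that] by simp
    then show ?thesis by (simp add: sum_negf)
  qed
  also have "(\<Sum>a\<in>S. \<Sum>b\<in>S. A a b * y a * y b) = (\<Sum>a\<in>S. y a * (\<Sum>b\<in>S. A a b * y b))"
    by (simp add: sum_distrib_left mult_ac)
  finally show ?thesis by simp
qed

definition node_dist :: "nat \<Rightarrow> (nat \<Rightarrow> nat \<Rightarrow> real) \<Rightarrow> nat \<Rightarrow> nat \<Rightarrow> real" where
  "node_dist n x i j = (\<Sum>a<n. (x i a - x j a)\<^sup>2)"

definition disagreement :: "nat \<Rightarrow> nat \<Rightarrow> (nat \<Rightarrow> nat \<Rightarrow> real) \<Rightarrow> (nat \<Rightarrow> nat \<Rightarrow> real) \<Rightarrow> real" where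
  "disagreement n N w x = (\<Sum>i<N. \<Sum>j<N. w i j * node_dist n x i j)"

text \<open>The term \<open>\<gamma>\<^sub>i P\<^sub>i (\<Sum>j. w\<^sub>i\<^sub>j (x\<^sub>i - x\<^sub>j))\<close>. Subtracted from the drift, it pulls node \<open>i\<close>
  towards its neighbours within the range of \<open>P\<^sub>i\<close>.\<close>

definition coupling ::
  "nat \<Rightarrow> nat \<Rightarrow> (nat \<Rightarrow> nat \<Rightarrow> nat \<Rightarrow> real) \<Rightarrow> (nat \<Rightarrow> real) \<Rightarrow> (nat \<Rightarrow> nat \<Rightarrow> real)
     \<Rightarrow> (nat \<Rightarrow> nat \<Rightarrow> real) \<Rightarrow> nat \<Rightarrow> nat \<Rightarrow> real" where
  "coupling n N P \<gamma> w x i a = \<gamma> i * (\<Sum>b<n. P i a b * (\<Sum>j<N. w i j * (x i b - x j b)))"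

text \<open>Symmetrisation: adding the sum to its copy with \<open>i\<close> and \<open>j\<close> exchanged turns \<open>x\<^sub>i \<cdot> (x\<^sub>i - x\<^sub>j)\<close> into
  \<open>|x\<^sub>i - x\<^sub>j|\<^sup>2\<close>.\<close>

lemma laplacian_form:
  fixes w :: "nat \<Rightarrow> nat \<Rightarrow> real"
  assumes "\<And>i j. i < N \<Longrightarrow> j < N \<Longrightarrow> w i j = w j i"
  shows "2 * (\<Sum>i<N. \<Sum>a<n. x i a * (\<Sum>j<N. w i j * (x i a - x j a))) = disagreement n N w x"
proof -
  let ?f = "\<lambda>i j. \<Sum>a<n. w i j * (x i a * (x i a - x j a))"
  have eq: "(\<Sum>i<N. \<Sum>a<n. x i a * (\<Sum>j<N. w i j * (x i a - x j a))) = (\<Sum>i<N. \<Sum>j<N. ?f i j)"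
  proof (rule sum.cong[OF refl])
    fix i
    have "(\<Sum>a<n. x i a * (\<Sum>j<N. w i j * (x i a - x j a)))
      = (\<Sum>a<n. \<Sum>j<N. w i j * (x i a * (x i a - x j a)))"
      by (simp add: sum_distrib_left mult_ac)
    also have "\<dots> = (\<Sum>j<N. ?f i j)" by (rule sum.swap)
    finally show "(\<Sum>a<n. x i a * (\<Sum>j<N. w i j * (x i a - x j a))) = (\<Sum>j<N. ?f i j)" .
  qed
  have "2 * (\<Sum>i<N. \<Sum>j<N. ?f i j) = (\<Sum>i<N. \<Sum>j<N. ?f i j) + (\<Sum>i<N. \<Sum>j<N. ?f j i)"
    by (subst (2) sum.swap) simp
  also have "\<dots> = (\<Sum>i<N. \<Sum>j<N. ?f i j + ?f j i)" by (simp add: sum.distrib)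
  also have "\<dots> = (\<Sum>i<N. \<Sum>j<N. w i j * node_dist n x i j)"
  proof (intro sum.cong refl)
    fix i j assume "i \<in> {..<N}" "j \<in> {..<N}"
    then have w: "w j i = w i j" using assms by simp
    show "?f i j + ?f j i = w i j * node_dist n x i j"
      unfolding w node_dist_def sum_distrib_left sum.distrib[symmetric]
      by (intro sum.cong refl) (simp add: power2_eq_square algebra_simps)
  qed
  finally show ?thesis unfolding eq disagreement_def .
qed

text \<open>The left-hand side is the derivative of \<open>\<Sum>i. |x\<^sub>i|\<^sup>2 / \<gamma>\<^sub>i\<close> along the flow. The weights \<open>1 / \<gamma>\<^sub>i\<close> cancel the
  gains, and \<open>x\<^sub>i \<cdot> P\<^sub>i r = x\<^sub>i \<cdot> r\<close> removes the projections, which leaves the quadratic form of the Laplacian.\<close>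

lemma energy_rate:
  fixes A :: "nat \<Rightarrow> nat \<Rightarrow> real" and P :: "nat \<Rightarrow> nat \<Rightarrow> nat \<Rightarrow> real"
  assumes skew: "\<And>a b. a < n \<Longrightarrow> b < n \<Longrightarrow> A b a = - A a b"
    and sym: "\<And>i j. i < N \<Longrightarrow> j < N \<Longrightarrow> w i j = w j i"
    and fixed: "\<And>i b. i < N \<Longrightarrow> b < n \<Longrightarrow> (\<Sum>a<n. x i a * P i a b) = x i b"
    and \<gamma>: "\<And>i. i < N \<Longrightarrow> \<gamma> i > 0"
  shows "(\<Sum>i<N. 1 / \<gamma> i * (\<Sum>a<n. 2 * x i a * ((\<Sum>b<n. A a b * x i b) - coupling n N P \<gamma> w x i a)))
    = - disagreement n N w x"
proof -
  have "1 / \<gamma> i * (\<Sum>a<n. 2 * x i a * ((\<Sum>b<n. A a b * x i b) - coupling n N P \<gamma> w x i a))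
    = - (2 * (\<Sum>b<n. x i b * (\<Sum>j<N. w i j * (x i b - x j b))))" if i: "i < N" for i
  proof -
    let ?r = "\<lambda>b. \<Sum>j<N. w i j * (x i b - x j b)"
    have "(\<Sum>a<n. x i a * (\<Sum>b<n. P i a b * ?r b)) = (\<Sum>a<n. \<Sum>b<n. x i a * P i a b * ?r b)"
      by (simp add: sum_distrib_left mult.assoc)
    also have "\<dots> = (\<Sum>b<n. (\<Sum>a<n. x i a * P i a b) * ?r b)"
      by (subst sum.swap) (simp only: sum_distrib_right)
    also have "\<dots> = (\<Sum>b<n. x i b * ?r b)" using fixed[OF i] by simp
    finally have c: "(\<Sum>a<n. x i a * coupling n N P \<gamma> w x i a) = \<gamma> i * (\<Sum>b<n. x i b * ?r b)"
      unfolding coupling_def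
      by (simp add: mult.left_commute[of _ "\<gamma> i"] sum_distrib_left[symmetric])
    have "(\<Sum>a<n. 2 * x i a * ((\<Sum>b<n. A a b * x i b) - coupling n N P \<gamma> w x i a))
      = 2 * (\<Sum>a<n. x i a * (\<Sum>b<n. A a b * x i b)) - 2 * (\<Sum>a<n. x i a * coupling n N P \<gamma> w x i a)"
      by (simp only: right_diff_distrib sum_subtractf sum_distrib_left mult.assoc)
    also have "(\<Sum>a<n. x i a * (\<Sum>b<n. A a b * x i b)) = 0"
      by (intro skew_form_zero skew) auto
    finally show ?thesis unfolding c using \<gamma>[OF i] by simp
  qed
  then have "(\<Sum>i<N. 1 / \<gamma> i * (\<Sum>a<n. 2 * x i a * ((\<Sum>b<n. A a b * x i b) - coupling n N P \<gamma> w x i a)))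
    = - (2 * (\<Sum>i<N. \<Sum>b<n. x i b * (\<Sum>j<N. w i j * (x i b - x j b))))"
    by (simp add: sum_negf sum_distrib_left)
  also have "\<dots> = - disagreement n N w x" using laplacian_form[OF sym] by simp
  finally show ?thesis .
qed

lemma node_dist_nonneg: "0 \<le> node_dist n x i j"
  by (simp add: node_dist_def sum_nonneg)

text \<open>The coupling vanishes along every edge without disagreement, so its square is of the order of the
  dissipation rate. The bound on the weights matters: \<open>w\<^sup>2 \<le> \<beta> w\<close>.\<close>

lemma coupling_bound:
  assumes w: "\<And>i j. i < N \<Longrightarrow> j < N \<Longrightarrow> 0 \<le> w i j" "\<And>i j. i < N \<Longrightarrow> j < N \<Longrightarrow> w i j \<le> \<beta>"
    and i: "i < N"
  shows "(\<Sum>a<n. (coupling n N P \<gamma> w x i a)\<^sup>2)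
    \<le> (\<Sum>i<N. (\<gamma> i)\<^sup>2 * (\<Sum>a<n. \<Sum>b<n. (P i a b)\<^sup>2)) * (real N * \<beta>) * disagreement n N w x"
proof -
  let ?r = "\<lambda>b. \<Sum>j<N. w i j * (x i b - x j b)"
  let ?F = "\<lambda>i. (\<gamma> i)\<^sup>2 * (\<Sum>a<n. \<Sum>b<n. (P i a b)\<^sup>2)"
  have \<beta>: "0 \<le> \<beta>" using w[OF i i] by linarith
  have row: "(\<Sum>j<N. w i j * node_dist n x i j) \<le> disagreement n N w x"
    unfolding disagreement_def
    by (rule member_le_sum[of i "{..<N}" "\<lambda>i. \<Sum>j<N. w i j * node_dist n x i j"])
      (use i w node_dist_nonneg in \<open>auto intro!: sum_nonneg\<close>)
  have r: "(\<Sum>b<n. (?r b)\<^sup>2) \<le> real N * \<beta> * disagreement n N w x"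
  proof -
    have "(?r b)\<^sup>2 \<le> real N * (\<Sum>j<N. \<beta> * (w i j * (x i b - x j b)\<^sup>2))" for b
    proof -
      have "(?r b)\<^sup>2 \<le> real N * (\<Sum>j<N. (w i j * (x i b - x j b))\<^sup>2)"
        using sum_mult_power2_le[of "\<lambda>_. 1" "\<lambda>j. w i j * (x i b - x j b)" "{..<N}"] by simp
      also have "\<dots> \<le> real N * (\<Sum>j<N. \<beta> * (w i j * (x i b - x j b)\<^sup>2))"
      proof (intro mult_left_mono sum_mono)
        fix j assume "j \<in> {..<N}"
        then have "w i j * (w i j * (x i b - x j b)\<^sup>2) \<le> \<beta> * (w i j * (x i b - x j b)\<^sup>2)"
          using w i by (intro mult_right_mono) auto
        then show "(w i j * (x i b - x j b))\<^sup>2 \<le> \<beta> * (w i j * (x i b - x j b)\<^sup>2)"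
          by (simp add: power2_eq_square mult_ac)
      qed simp
      finally show ?thesis .
    qed
    then have "(\<Sum>b<n. (?r b)\<^sup>2) \<le> (\<Sum>b<n. real N * (\<Sum>j<N. \<beta> * (w i j * (x i b - x j b)\<^sup>2)))"
      by (intro sum_mono)
    also have "\<dots> = real N * \<beta> * (\<Sum>b<n. \<Sum>j<N. w i j * (x i b - x j b)\<^sup>2)"
      by (simp add: sum_distrib_left mult_ac)
    also have "(\<Sum>b<n. \<Sum>j<N. w i j * (x i b - x j b)\<^sup>2) = (\<Sum>j<N. w i j * node_dist n x i j)"
      by (subst sum.swap) (simp add: node_dist_def sum_distrib_left)
    also have "real N * \<beta> * \<dots> \<le> real N * \<beta> * disagreement n N w x"
      using row \<beta> by (intro mult_left_mono) auto
    finally show ?thesis .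
  qed
  have "(\<Sum>a<n. (coupling n N P \<gamma> w x i a)\<^sup>2) = (\<gamma> i)\<^sup>2 * (\<Sum>a<n. (\<Sum>b<n. P i a b * ?r b)\<^sup>2)"
    unfolding coupling_def by (simp only: power_mult_distrib sum_distrib_left[symmetric])
  also have "\<dots> \<le> (\<gamma> i)\<^sup>2 * ((\<Sum>a<n. \<Sum>b<n. (P i a b)\<^sup>2) * (\<Sum>b<n. (?r b)\<^sup>2))"
    by (rule mult_left_mono[OF frobenius_bound zero_le_power2])
  also have "\<dots> = ?F i * (\<Sum>b<n. (?r b)\<^sup>2)" by (simp only: mult.assoc)
  also have "\<dots> \<le> (\<Sum>i<N. ?F i) * (real N * \<beta> * disagreement n N w x)"
  proof (rule mult_mono[OF _ r])
    show "?F i \<le> (\<Sum>i<N. ?F i)"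
      by (rule member_le_sum[of i "{..<N}" ?F]) (use i in \<open>auto intro!: mult_nonneg_nonneg sum_nonneg\<close>)
    show "0 \<le> (\<Sum>i<N. ?F i)" by (intro sum_nonneg mult_nonneg_nonneg) auto
  qed (auto intro!: sum_nonneg)
  finally show ?thesis by (simp add: mult.assoc)
qed

text \<open>The right-hand side is the derivative of \<open>|x\<^sub>i - x\<^sub>j|\<^sup>2\<close>. Both nodes have the same drift \<open>A\<close>, which acts on the
  difference as a skew-symmetric map and cannot change its length; only the two coupling terms remain.\<close>

lemma node_dist_rate:
  fixes A :: "nat \<Rightarrow> nat \<Rightarrow> real" and h :: "nat \<Rightarrow> nat \<Rightarrow> real"
  assumes skew: "\<And>a b. a < n \<Longrightarrow> b < n \<Longrightarrow> A b a = - A a b"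
    and h: "(\<Sum>a<n. (h i a)\<^sup>2) \<le> H" "(\<Sum>a<n. (h j a)\<^sup>2) \<le> H"
  shows "- (node_dist n x i j + 4 * H) \<le>
    (\<Sum>a<n. 2 * (x i a - x j a) * (((\<Sum>b<n. A a b * x i b) - h i a) - ((\<Sum>b<n. A a b * x j b) - h j a)))"
proof -
  let ?e = "\<lambda>a. x i a - x j a"
  let ?f = "\<lambda>a. ((\<Sum>b<n. A a b * x i b) - h i a) - ((\<Sum>b<n. A a b * x j b) - h j a)"
  have lin: "(\<Sum>b<n. A a b * ?e b) = (\<Sum>b<n. A a b * x i b) - (\<Sum>b<n. A a b * x j b)" for a
    by (simp add: right_diff_distrib sum_subtractf)
  have "2 * ?e a * ?f a = 2 * (?e a * (\<Sum>b<n. A a b * ?e b)) - 2 * ?e a * (h i a - h j a)" for a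
    unfolding lin by (simp add: algebra_simps)
  then have "(\<Sum>a<n. 2 * ?e a * ?f a)
    = 2 * (\<Sum>a<n. ?e a * (\<Sum>b<n. A a b * ?e b)) - (\<Sum>a<n. 2 * ?e a * (h i a - h j a))"
    by (simp only: sum_subtractf sum_distrib_left[of 2 _ "{..<n}"])
  moreover have "(\<Sum>a<n. ?e a * (\<Sum>b<n. A a b * ?e b)) = 0"
    by (intro skew_form_zero skew) auto
  ultimately have eq: "(\<Sum>a<n. 2 * ?e a * ?f a) = - (\<Sum>a<n. 2 * ?e a * (h i a - h j a))"
    by linarith
  have "2 * ?e a * (h i a - h j a) \<le> (?e a)\<^sup>2 + (2 * (h i a)\<^sup>2 + 2 * (h j a)\<^sup>2)" for a
    using zero_le_power2[of "?e a - (h i a - h j a)"] zero_le_power2[of "h i a + h j a"]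
    by (simp add: power2_eq_square algebra_simps)
  then have "(\<Sum>a<n. 2 * ?e a * (h i a - h j a)) \<le> (\<Sum>a<n. (?e a)\<^sup>2 + (2 * (h i a)\<^sup>2 + 2 * (h j a)\<^sup>2))"
    by (intro sum_mono)
  also have "\<dots> = node_dist n x i j + 2 * (\<Sum>a<n. (h i a)\<^sup>2) + 2 * (\<Sum>a<n. (h j a)\<^sup>2)"
    by (simp add: sum.distrib sum_distrib_left node_dist_def)
  finally show ?thesis unfolding eq using h by linarith
qed

text \<open>Since \<open>x\<^sub>i\<close> is fixed by \<open>P\<^sub>i\<close>, the vector \<open>x\<^sub>j - P\<^sub>i x\<^sub>j\<close> equals \<open>(x\<^sub>j - x\<^sub>i) + P\<^sub>i (x\<^sub>i - x\<^sub>j)\<close> and is small when the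
  two nodes nearly agree. The hypothesis on \<open>B\<close> is joint observability in quantitative form.\<close>

lemma energy_le_node_dist:
  fixes P :: "nat \<Rightarrow> nat \<Rightarrow> nat \<Rightarrow> real"
  assumes obs: "\<And>y :: nat \<Rightarrow> real. (\<Sum>a<n. (y a)\<^sup>2) \<le> B * (\<Sum>i<N. \<Sum>a<n. (y a - (\<Sum>b<n. P i a b * y b))\<^sup>2)"
    and "0 \<le> B"
    and fixed: "\<And>i a. i < N \<Longrightarrow> a < n \<Longrightarrow> (\<Sum>b<n. P i a b * x i b) = x i a"
    and j: "j < N"
  shows "(\<Sum>a<n. (x j a)\<^sup>2)
    \<le> B * (2 + 2 * (\<Sum>i<N. \<Sum>a<n. \<Sum>b<n. (P i a b)\<^sup>2)) * (\<Sum>i<N. node_dist n x i j)"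
proof -
  let ?F = "\<lambda>i. \<Sum>a<n. \<Sum>b<n. (P i a b)\<^sup>2"
  have "(\<Sum>a<n. (x j a - (\<Sum>b<n. P i a b * x j b))\<^sup>2) \<le> (2 + 2 * (\<Sum>i<N. ?F i)) * node_dist n x i j"
    if i: "i < N" for i
  proof -
    have "(\<Sum>a<n. (x j a - (\<Sum>b<n. P i a b * x j b))\<^sup>2)
      \<le> 2 * (\<Sum>a<n. (x j a - x i a)\<^sup>2) + 2 * (\<Sum>a<n. (x i a - (\<Sum>b<n. P i a b * x j b))\<^sup>2)"
      by (rule sum_diff_power2_le)
    also have "(\<Sum>a<n. (x j a - x i a)\<^sup>2) = node_dist n x i j"
      by (simp add: node_dist_def power2_commute)
    also have "(\<Sum>a<n. (x i a - (\<Sum>b<n. P i a b * x j b))\<^sup>2) = (\<Sum>a<n. (\<Sum>b<n. P i a b * (x i b - x j b))\<^sup>2)"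
      using fixed[OF i] by (simp add: right_diff_distrib sum_subtractf)
    also have "\<dots> \<le> ?F i * node_dist n x i j"
      unfolding node_dist_def by (rule frobenius_bound)
    also have "\<dots> \<le> (\<Sum>i<N. ?F i) * node_dist n x i j"
      by (intro mult_right_mono member_le_sum[of i "{..<N}" ?F] node_dist_nonneg)
        (use i in \<open>auto intro!: sum_nonneg\<close>)
    finally show ?thesis by (simp add: algebra_simps)
  qed
  then have "(\<Sum>i<N. \<Sum>a<n. (x j a - (\<Sum>b<n. P i a b * x j b))\<^sup>2)
    \<le> (\<Sum>i<N. (2 + 2 * (\<Sum>i<N. ?F i)) * node_dist n x i j)"
    by (intro sum_mono) auto
  then have "B * (\<Sum>i<N. \<Sum>a<n. (x j a - (\<Sum>b<n. P i a b * x j b))\<^sup>2)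
    \<le> B * ((2 + 2 * (\<Sum>i<N. ?F i)) * (\<Sum>i<N. node_dist n x i j))"
    using \<open>0 \<le> B\<close> by (intro mult_left_mono) (auto simp: sum_distrib_left)
  with obs[of "x j"] show ?thesis by (simp add: mult.assoc)
qed

section \<open>Unobservable subspaces\<close>

lemma mat_mult_index_sum:
  assumes "X \<in> carrier_mat r k" "Y \<in> carrier_mat k c" "i < r" "j < c"
  shows "(X * Y) $$ (i, j) = (\<Sum>a<k. X $$ (i, a) * Y $$ (a, j))"
  using assms by (simp add: scalar_prod_def lessThan_atLeast0)

lemma mult_mat_vec_index_sum:
  assumes "X \<in> carrier_mat r k" "v \<in> carrier_vec k" "i < r"
  shows "(X *\<^sub>v v) $ i = (\<Sum>a<k. X $$ (i, a) * v $ a)"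
  using assms by (simp add: scalar_prod_def lessThan_atLeast0)

text \<open>The highest index with a nonzero coefficient lets the recurrence express each term by earlier ones.
  Any linear dependence among the powers of a matrix can thus play the role of its characteristic equation.\<close>

lemma linear_recurrence_zero:
  fixes y w :: "nat \<Rightarrow> real"
  assumes rec: "\<And>l. (\<Sum>j\<le>n. w j * y (j + l)) = 0" and nz: "\<exists>j\<le>n. w j \<noteq> 0"
    and init: "\<And>k. k < n \<Longrightarrow> y k = 0"
  shows "y k = 0"
proof (induction k rule: less_induct)
  case (less k)
  (* p is the order of the recurrence; solving it for the term of index k requires k >= p, which p <= n
     gives. *)
  define p where "p = Max {j. j \<le> n \<and> w j \<noteq> 0}"
  have fin: "finite {j. j \<le> n \<and> w j \<noteq> 0}" by simp
  have p: "p \<le> n" "w p \<noteq> 0" using Max_in[OF fin] nz unfolding p_def by auto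
  have above: "w j = 0" if "p < j" "j \<le> n" for j
    using Max_ge[OF fin, of j] that unfolding p_def by fastforce
  show ?case
  proof (cases "k < n")
    case False
    define l where "l = k - p"
    have k: "k = p + l" using False p by (simp add: l_def)
    have "w j * y (j + l) = 0" if "j \<in> {..n} - {p}" for j
    proof (cases "j < p")
      case True
      then show ?thesis using less.IH[of "j + l"] k by simp
    next
      case False
      then show ?thesis using above[of j] that by simp
    qed
    then have "(\<Sum>j\<in>{..n} - {p}. w j * y (j + l)) = 0" by (rule sum.neutral[OF ballI])
    then have "(\<Sum>j\<le>n. w j * y (j + l)) = w p * y (p + l)"
      using p by (subst sum.remove[of _ p]) auto
    then show ?thesis using rec[of l] p k by simp
  qed (use init in simp)
qed

text \<open>Vectors \<open>v 0, \<dots>, v n\<close> in dimension \<open>n\<close> are dependent: written as columns and completed by a zero row they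
  form a singular square matrix.\<close>

lemma krylov_dependence:
  fixes v :: "nat \<Rightarrow> nat \<Rightarrow> real"
  obtains w :: "nat \<Rightarrow> real" where "\<exists>j\<le>n. w j \<noteq> 0" "\<And>i. i < n \<Longrightarrow> (\<Sum>j\<le>n. w j * v j i) = 0"
proof -
  define K where "K = mat (Suc n) (Suc n) (\<lambda>(i, j). if i < n then v j i else 0)"
  have K: "K \<in> carrier_mat (Suc n) (Suc n)" by (simp add: K_def)
  have "K\<^sup>T *\<^sub>v unit_vec (Suc n) n = 0\<^sub>v (Suc n)"
    by (rule eq_vecI) (auto simp: K_def)
  then have "det (K\<^sup>T) = 0"
    using K by (subst det_0_iff_vec_prod_zero_field[of _ "Suc n"])
      (auto intro!: exI[of _ "unit_vec (Suc n) n"] unit_vec_nonzero)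
  then have "det K = 0" using det_transpose[OF K] by simp
  then obtain z where z: "z \<in> carrier_vec (Suc n)" "z \<noteq> 0\<^sub>v (Suc n)" "K *\<^sub>v z = 0\<^sub>v (Suc n)"
    unfolding det_0_iff_vec_prod_zero_field[OF K] by blast
  show thesis
  proof (rule that[of "\<lambda>j. z $ j"])
    show "\<exists>j\<le>n. z $ j \<noteq> 0"
      using z(1,2) by (auto simp: vec_eq_iff less_Suc_eq_le)
    fix i assume i: "i < n"
    have "(K *\<^sub>v z) $ i = 0" using z(3) i by simp
    moreover have "(K *\<^sub>v z) $ i = (\<Sum>j = 0..<Suc n. v j i * z $ j)"
      using i z(1) by (simp add: K_def scalar_prod_def)
    moreover have "{0..<Suc n} = {..n}" by auto
    ultimately show "(\<Sum>j\<le>n. z $ j * v j i) = 0" by (simp only: mult.commute)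
  qed
qed

lemma pow_mat_mult_vec:
  assumes "A \<in> carrier_mat n n" "v \<in> carrier_vec n"
  shows "A ^\<^sub>m k *\<^sub>v v = ((*\<^sub>v) A ^^ k) v"
  using assms(2)
proof (induction k arbitrary: v)
  case 0
  then show ?case using assms(1) by simp
next
  case (Suc k)
  have "A ^\<^sub>m Suc k *\<^sub>v v = A ^\<^sub>m k *\<^sub>v (A *\<^sub>v v)"
    using assms(1) Suc.prems by (simp add: assoc_mult_mat_vec[of _ n n _ n])
  then show ?case
    using Suc assms(1) by (simp add: funpow_swap1)
qed

text \<open>The dependence among \<open>v, A v, \<dots>, A\<^sup>n v\<close> persists when \<open>A\<close> is applied to it, so the numbers
  \<open>c \<bullet> A\<^sup>k v\<close> satisfy a linear recurrence of order at most \<open>n\<close>. This is the consequence of the Cayley--Hamilton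
  theorem that observability theory uses.\<close>

lemma functional_vanishes_on_orbit:
  fixes A :: "real mat"
  assumes A: "A \<in> carrier_mat n n" and v: "v \<in> carrier_vec n" and c: "c \<in> carrier_vec n"
    and init: "\<And>k. k < n \<Longrightarrow> c \<bullet> (A ^\<^sub>m k *\<^sub>v v) = 0"
  shows "c \<bullet> (A ^\<^sub>m k *\<^sub>v v) = 0"
proof -
  define z where "z k = ((*\<^sub>v) A ^^ k) v" for k
  have z: "z k \<in> carrier_vec n" for k
    unfolding z_def using A v by (induction k) auto
  have zSuc: "z (Suc k) $ i = (\<Sum>b = 0..<n. A $$ (i, b) * z k $ b)" if "i < n" for k i
  proof -
    have "z (Suc k) = A *\<^sub>v z k" by (simp add: z_def)
    then show ?thesis using A z[of k] that by (simp add: scalar_prod_def)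
  qed
  obtain w :: "nat \<Rightarrow> real" where w: "\<exists>j\<le>n. w j \<noteq> 0" "\<And>i. i < n \<Longrightarrow> (\<Sum>j\<le>n. w j * z j $ i) = 0"
    by (rule krylov_dependence[of n "\<lambda>j i. z j $ i"]) blast
  have rec: "(\<Sum>j\<le>n. w j * z (j + l) $ i) = 0" if "i < n" for l i
    using that
  proof (induction l arbitrary: i)
    case 0
    then show ?case using w by simp
  next
    case (Suc l)
    have "(\<Sum>j\<le>n. w j * z (j + Suc l) $ i) = (\<Sum>j\<le>n. \<Sum>b = 0..<n. A $$ (i, b) * (w j * z (j + l) $ b))"
      using zSuc[OF Suc.prems] by (simp add: sum_distrib_left mult.left_commute)
    also have "\<dots> = (\<Sum>b = 0..<n. A $$ (i, b) * (\<Sum>j\<le>n. w j * z (j + l) $ b))"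
      by (subst sum.swap) (simp add: sum_distrib_left)
    also have "\<dots> = 0" using Suc.IH by simp
    finally show ?case .
  qed
  have "c \<bullet> z k = 0"
  proof (rule linear_recurrence_zero[where w = w and y = "\<lambda>k. c \<bullet> z k"])
    fix l
    have "(\<Sum>j\<le>n. w j * (c \<bullet> z (j + l))) = (\<Sum>j\<le>n. \<Sum>b = 0..<n. c $ b * (w j * z (j + l) $ b))"
      by (simp add: scalar_prod_def carrier_vecD[OF z] sum_distrib_left mult.left_commute)
    also have "\<dots> = (\<Sum>b = 0..<n. c $ b * (\<Sum>j\<le>n. w j * z (j + l) $ b))"
      by (subst sum.swap) (simp add: sum_distrib_left)
    also have "\<dots> = 0" using rec by simp
    finally show "(\<Sum>j\<le>n. w j * (c \<bullet> z (j + l))) = 0" .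
  next
    show "c \<bullet> z k = 0" if "k < n" for k
      using init[OF that] by (simp add: z_def pow_mat_mult_vec[OF A v])
  qed (rule w(1))
  then show ?thesis by (simp add: z_def pow_mat_mult_vec[OF A v])
qed

lemma mult_mat_vec_zero_iff: "M *\<^sub>v v = 0\<^sub>v (dim_row M) \<longleftrightarrow> (\<forall>r \<in> set (rows M). r \<bullet> v = 0)"
proof
  assume zero: "M *\<^sub>v v = 0\<^sub>v (dim_row M)"
  have "row M i \<bullet> v = 0" if "i < dim_row M" for i
    using arg_cong[OF zero, of "\<lambda>u. u $ i"] that by simp
  then show "\<forall>r \<in> set (rows M). r \<bullet> v = 0" by (auto simp: rows_def)
next
  assume zero: "\<forall>r \<in> set (rows M). r \<bullet> v = 0"
  show "M *\<^sub>v v = 0\<^sub>v (dim_row M)"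
    by (rule eq_vecI) (use zero in \<open>auto simp: rows_def\<close>)
qed

lemma mat_kernel_stack_mat:
  assumes "\<And>X. X \<in> set Xs \<Longrightarrow> X \<in> carrier_mat (dim_row X) n"
  shows "v \<in> mat_kernel (stack_mat n Xs) \<longleftrightarrow>
    v \<in> carrier_vec n \<and> (\<forall>X \<in> set Xs. X *\<^sub>v v = 0\<^sub>v (dim_row X))"
proof -
  have sub: "set (concat (map rows Xs)) \<subseteq> carrier_vec n"
  proof
    fix r assume "r \<in> set (concat (map rows Xs))"
    then obtain X where X: "X \<in> set Xs" "r \<in> set (rows X)" by auto
    then have "r \<in> carrier_vec (dim_col X)" using rows_carrier by blast
    then show "r \<in> carrier_vec n" using carrier_matD(2)[OF assms[OF X(1)]] by simp
  qed
  show ?thesis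
    unfolding mat_kernel_def mem_Collect_eq mult_mat_vec_zero_iff
    unfolding stack_mat_def rows_mat_of_rows[OF sub] by auto
qed

text \<open>A state is unobservable if the first \<open>n\<close> derivatives of its output (of orders \<open>0, \<dots>, n - 1\<close>) vanish.\<close>

lemma mat_kernel_observability_mat:
  assumes A: "A \<in> carrier_mat n n" and C: "C \<in> carrier_mat m n"
  shows "v \<in> mat_kernel (observability_mat C A) \<longleftrightarrow>
    v \<in> carrier_vec n \<and> (\<forall>k<n. C *\<^sub>v (A ^\<^sub>m k *\<^sub>v v) = 0\<^sub>v m)"
proof -
  have [simp]: "dim_row A = n" using A by simp
  have "v \<in> mat_kernel (observability_mat C A) \<longleftrightarrow>
    v \<in> carrier_vec n \<and> (\<forall>k<n. (C * A ^\<^sub>m k) *\<^sub>v v = 0\<^sub>v m)"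
    unfolding observability_mat_def
    by (subst mat_kernel_stack_mat) (use A C in auto)
  also have "\<dots> \<longleftrightarrow> v \<in> carrier_vec n \<and> (\<forall>k<n. C *\<^sub>v (A ^\<^sub>m k *\<^sub>v v) = 0\<^sub>v m)"
    using assoc_mult_mat_vec[OF C pow_carrier_mat[OF A]] by auto
  finally show ?thesis .
qed

lemma unobservable_subspace_invariant:
  fixes A :: "real mat"
  assumes A: "A \<in> carrier_mat n n" and C: "C \<in> carrier_mat m n"
    and v: "v \<in> mat_kernel (observability_mat C A)"
  shows "A *\<^sub>v v \<in> mat_kernel (observability_mat C A)"
proof -
  have vn: "v \<in> carrier_vec n" and init: "\<And>k. k < n \<Longrightarrow> C *\<^sub>v (A ^\<^sub>m k *\<^sub>v v) = 0\<^sub>v m"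
    using iffD1[OF mat_kernel_observability_mat[OF A C] v] by blast+
  have all: "C *\<^sub>v (A ^\<^sub>m k *\<^sub>v v) = 0\<^sub>v m" for k
  proof (rule eq_vecI)
    fix r assume "r < dim_vec (0\<^sub>v m)"
    then have r: "r < m" by simp
    have "row C r \<bullet> (A ^\<^sub>m k *\<^sub>v v) = 0"
    proof (rule functional_vanishes_on_orbit[OF A vn])
      show "row C r \<in> carrier_vec n" using C by (intro carrier_vecI) simp
      show "row C r \<bullet> (A ^\<^sub>m k *\<^sub>v v) = 0" if "k < n" for k
        using arg_cong[OF init[OF that], of "\<lambda>u. u $ r"] r C by simp
    qed
    then show "(C *\<^sub>v (A ^\<^sub>m k *\<^sub>v v)) $ r = 0\<^sub>v m $ r" using r C by simp
  qed (use C in simp)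
  have "A ^\<^sub>m k *\<^sub>v (A *\<^sub>v v) = A ^\<^sub>m Suc k *\<^sub>v v" for k
    using assoc_mult_mat_vec[OF pow_carrier_mat[OF A] A vn] by simp
  then show ?thesis
    unfolding mat_kernel_observability_mat[OF A C] using all A vn by (simp del: pow_mat.simps)
qed

text \<open>Full rank forces the columns to be distinct before it makes them independent, because the rank is that
  of the set of columns.\<close>

lemma full_column_rank_kernel:
  fixes M :: "real mat"
  assumes M: "M \<in> carrier_mat r c" and rank: "vec_space.rank r M = c"
    and v: "v \<in> carrier_vec c" "M *\<^sub>v v = 0\<^sub>v r"
  shows "v = 0\<^sub>v c"
proof -
  interpret vec_space "TYPE(real)" r .
  obtain S where S: "maximal S (\<lambda>T. T \<subseteq> set (cols M) \<and> lin_indpt T)"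
    using maximal_exists[of "(\<lambda>T. T \<subseteq> set (cols M) \<and> lin_indpt T)" "card (set (cols M))" "{}"]
    by (meson List.finite_set card_mono empty_iff empty_subsetI finite_lin_indpt2 rev_finite_subset)
  have "c = card S" using rank_card_indpt[OF M S] rank by simp
  also have "\<dots> \<le> card (set (cols M))" using S by (simp add: card_mono maximal_def)
  finally have distinct: "distinct (cols M)"
    using M card_length[of "cols M"] by (intro card_distinct) simp
  have "lin_indpt (set (cols M))" by (rule full_rank_lin_indpt[OF M rank distinct])
  then show ?thesis using lin_depI[OF M v(1) _ v(2) distinct] by blast
qed

lemma common_unobservable_subspace_trivial:
  fixes A :: "real mat"
  assumes A: "A \<in> carrier_mat n n" and C: "\<And>i. i < N \<Longrightarrow> C i \<in> carrier_mat (m i) n"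
    and obs: "observable (stack_mat n (map C [0..<N])) A"
    and v: "v \<in> carrier_vec n" "\<And>i. i < N \<Longrightarrow> v \<in> mat_kernel (observability_mat (C i) A)"
  shows "v = 0\<^sub>v n"
proof -
  let ?C = "stack_mat n (map C [0..<N])"
  let ?O = "observability_mat ?C A"
  have dim: "dim_row A = n" using A by simp
  have Cs: "?C \<in> carrier_mat (dim_row ?C) n" by (auto simp: stack_mat_def)
  have O: "?O \<in> carrier_mat (dim_row ?O) n" using dim by (auto simp: observability_mat_def stack_mat_def)
  have "?C *\<^sub>v (A ^\<^sub>m k *\<^sub>v v) = 0\<^sub>v (dim_row ?C)" if k: "k < n" for k
  proof -
    have "A ^\<^sub>m k *\<^sub>v v \<in> mat_kernel ?C"
    proof (subst mat_kernel_stack_mat, safe)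
      fix X assume "X \<in> set (map C [0..<N])"
      then obtain i where i: "X = C i" "i < N" by auto
      show "X \<in> carrier_mat (dim_row X) n" using C i by auto
      show "X *\<^sub>v (A ^\<^sub>m k *\<^sub>v v) = 0\<^sub>v (dim_row X)"
        using v(2)[OF i(2)] k C[OF i(2)] i by (simp add: mat_kernel_observability_mat[OF A C[OF i(2)]])
    qed (use A v in \<open>auto intro: mult_mat_vec_carrier[OF pow_carrier_mat]\<close>)
    then show ?thesis by (simp add: mat_kernel_def)
  qed
  then have "v \<in> mat_kernel ?O"
    unfolding mat_kernel_observability_mat[OF A Cs] using v by simp
  then have "?O *\<^sub>v v = 0\<^sub>v (dim_row ?O)" by (simp add: mat_kernel_def)
  with obs show ?thesis
    using full_column_rank_kernel[OF O _ v(1)] dim by (simp add: observable_def)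
qed

lemma orthonormal_basis_cols_image:
  assumes U: "U \<in> carrier_mat n d" and basis: "orthonormal_basis_cols U W"
  shows "W = {U *\<^sub>v z | z. z \<in> carrier_vec d}"
proof -
  interpret vec_space "TYPE(real)" n .
  have "W = col_space U" using basis U by (simp add: orthonormal_basis_cols_def)
  then show ?thesis using U by (auto simp: col_space_eq[OF U])
qed

lemma orthonormal_basis_cols_projection:
  assumes U: "U \<in> carrier_mat n d" and basis: "orthonormal_basis_cols U W" and x: "x \<in> W"
  shows "(U * U\<^sup>T) *\<^sub>v x = x"
proof -
  obtain z where z: "x = U *\<^sub>v z" "z \<in> carrier_vec d"
    using x unfolding orthonormal_basis_cols_image[OF U basis] by blast
  have UT: "U\<^sup>T \<in> carrier_mat d n" using U by simp
  have one: "U\<^sup>T * U = 1\<^sub>m d" using basis U by (simp add: orthonormal_basis_cols_def)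
  have "U\<^sup>T *\<^sub>v x = z"
    using assoc_mult_mat_vec[OF UT U z(2)] one z by simp
  then show ?thesis
    using assoc_mult_mat_vec[OF U UT] z U by auto
qed

lemma mat_eqI_mult_vec:
  fixes X Y :: "real mat"
  assumes X: "X \<in> carrier_mat r c" and Y: "Y \<in> carrier_mat r c"
    and eq: "\<And>z. z \<in> carrier_vec c \<Longrightarrow> X *\<^sub>v z = Y *\<^sub>v z"
  shows "X = Y"
proof (rule eq_matI)
  fix i j assume ij: "i < dim_row Y" "j < dim_col Y"
  have "(X *\<^sub>v unit_vec c j) $ i = (Y *\<^sub>v unit_vec c j) $ i" using eq[of "unit_vec c j"] by simp
  then show "X $$ (i, j) = Y $$ (i, j)" using ij X Y by simp
qed (use X Y in auto)

text \<open>For \<open>U z \<in> W\<close> the vector \<open>A U z\<close> is again in \<open>W\<close>, where \<open>U U\<^sup>T\<close> acts as the identity. This is where the block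
  form of \<open>A\<close> with respect to the unobservable subspace is used.\<close>

lemma invariant_subspace_projection:
  fixes A U :: "real mat"
  assumes A: "A \<in> carrier_mat n n" and U: "U \<in> carrier_mat n d"
    and basis: "orthonormal_basis_cols U W" and inv: "\<And>x. x \<in> W \<Longrightarrow> A *\<^sub>v x \<in> W"
  shows "U * unobservable_part A U = A * U"
proof (rule mat_eqI_mult_vec)
  have UT: "U\<^sup>T \<in> carrier_mat d n" using U by simp
  show "U * unobservable_part A U \<in> carrier_mat n d" "A * U \<in> carrier_mat n d"
    using A U by (auto simp: unobservable_part_def)
  fix z :: "real vec" assume z: "z \<in> carrier_vec d"
  have "U *\<^sub>v z \<in> W" unfolding orthonormal_basis_cols_image[OF U basis] using z by blast
  then have AUz: "A *\<^sub>v (U *\<^sub>v z) \<in> W" by (rule inv)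
  have carr: "A *\<^sub>v (U *\<^sub>v z) \<in> carrier_vec n" using A by (intro carrier_vecI) simp
  have "(U * unobservable_part A U) *\<^sub>v z = U *\<^sub>v (U\<^sup>T *\<^sub>v (A *\<^sub>v (U *\<^sub>v z)))"
    using A U UT z unfolding unobservable_part_def
    by (simp add: assoc_mult_mat_vec[of _ _ d _ d] assoc_mult_mat_vec[of _ d n _ d]
      assoc_mult_mat_vec[of _ d n _ n] mult_carrier_mat[of _ d n _ d] mult_carrier_mat[of _ d n _ n]
      assoc_mult_mat_vec[of _ n d _ d] assoc_mult_mat_vec[of _ d n _ n])
  also have "\<dots> = A *\<^sub>v (U *\<^sub>v z)"
    using orthonormal_basis_cols_projection[OF U basis AUz] assoc_mult_mat_vec[OF U UT carr] by simp
  also have "\<dots> = (A * U) *\<^sub>v z" using assoc_mult_mat_vec[OF A U z] by simp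
  finally show "(U * unobservable_part A U) *\<^sub>v z = (A * U) *\<^sub>v z" .
qed

text \<open>An injective square matrix has a left inverse, and the norm of that inverse gives the bound.\<close>

lemma injective_matrix_bounded_below:
  fixes M :: "nat \<Rightarrow> nat \<Rightarrow> real"
  assumes inj: "\<And>y a. (\<And>a. a < n \<Longrightarrow> (\<Sum>b<n. M a b * y b) = 0) \<Longrightarrow> a < n \<Longrightarrow> y a = 0"
  obtains B where "0 \<le> B" "\<And>y. (\<Sum>a<n. (y a)\<^sup>2) \<le> B * (\<Sum>a<n. (\<Sum>b<n. M a b * y b)\<^sup>2)"
proof -
  define X where "X = mat n n (\<lambda>(a, b). M a b)"
  have X: "X \<in> carrier_mat n n" by (simp add: X_def)
  have prod: "(X *\<^sub>v z) $ a = (\<Sum>b<n. M a b * z $ b)" if "z \<in> carrier_vec n" "a < n" for z a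
    using that by (simp add: X_def scalar_prod_def lessThan_atLeast0)
  have "det X \<noteq> 0"
  proof
    assume "det X = 0"
    then obtain z where z: "z \<in> carrier_vec n" "z \<noteq> 0\<^sub>v n" "X *\<^sub>v z = 0\<^sub>v n"
      unfolding det_0_iff_vec_prod_zero_field[OF X] by blast
    have "(\<Sum>b<n. M a b * z $ b) = 0" if "a < n" for a
      using prod[OF z(1) that] z(3) that by simp
    then have "z $ a = 0" if "a < n" for a using inj[of "\<lambda>a. z $ a"] that by blast
    then show False using z by auto
  qed
  then obtain Y where Y: "Y \<in> carrier_mat n n" "Y * X = 1\<^sub>m n"
    using det_non_zero_imp_unit[OF X, of "()"] by (auto simp: Units_def ring_mat_def)
  show thesis
  proof (rule that)
    show "0 \<le> (\<Sum>a<n. \<Sum>b<n. (Y $$ (a, b))\<^sup>2)" by (intro sum_nonneg) auto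
    fix y :: "nat \<Rightarrow> real"
    define z where "z = vec n y"
    have z: "z \<in> carrier_vec n" by (simp add: z_def)
    have inverse: "y a = (\<Sum>b<n. Y $$ (a, b) * (\<Sum>c<n. M b c * y c))" if "a < n" for a
    proof -
      have "Y *\<^sub>v (X *\<^sub>v z) = z" using assoc_mult_mat_vec[OF Y(1) X z] Y(2) z by simp
      then have "y a = (Y *\<^sub>v (X *\<^sub>v z)) $ a" using that by (simp add: z_def)
      also have "\<dots> = (\<Sum>b<n. Y $$ (a, b) * (X *\<^sub>v z) $ b)"
        using that Y X by (simp add: scalar_prod_def lessThan_atLeast0)
      also have "\<dots> = (\<Sum>b<n. Y $$ (a, b) * (\<Sum>c<n. M b c * y c))"
        by (intro sum.cong refl) (simp add: prod[OF z], simp add: z_def)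
      finally show ?thesis .
    qed
    have "(\<Sum>a<n. (y a)\<^sup>2) = (\<Sum>a<n. (\<Sum>b<n. Y $$ (a, b) * (\<Sum>c<n. M b c * y c))\<^sup>2)"
      by (rule sum.cong[OF refl], rule arg_cong[of _ _ "\<lambda>x. x\<^sup>2"], rule inverse, simp)
    also have "\<dots> \<le> (\<Sum>a<n. \<Sum>b<n. (Y $$ (a, b))\<^sup>2) * (\<Sum>a<n. (\<Sum>b<n. M a b * y b)\<^sup>2)"
      by (rule frobenius_bound)
    finally show "(\<Sum>a<n. (y a)\<^sup>2) \<le> (\<Sum>a<n. \<Sum>b<n. (Y $$ (a, b))\<^sup>2) * (\<Sum>a<n. (\<Sum>b<n. M a b * y b)\<^sup>2)" .
  qed
qed

text \<open>The hypothesis on products says \<open>P\<^sub>i\<^sup>T P\<^sub>i = P\<^sub>i\<close>, that is, \<open>P\<^sub>i\<close> is an orthogonal projection. Then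
  \<open>y \<cdot> (y - P\<^sub>i y) = |y - P\<^sub>i y|\<^sup>2\<close>, so the matrix \<open>M = \<Sum>i. (1 - P\<^sub>i)\<close> is injective as soon as the ranges of
  the projections have no common nonzero vector, and \<open>M y\<close> is the sum of the vectors \<open>y - P\<^sub>i y\<close>.\<close>

lemma distance_to_fixed_spaces:
  fixes P :: "nat \<Rightarrow> nat \<Rightarrow> nat \<Rightarrow> real"
  assumes proj: "\<And>i b c. i < N \<Longrightarrow> b < n \<Longrightarrow> c < n \<Longrightarrow> (\<Sum>a<n. P i a b * P i a c) = P i b c"
    and triv: "\<And>y. \<forall>i<N. \<forall>a<n. (\<Sum>b<n. P i a b * y b) = y a \<Longrightarrow> \<forall>a<n. y a = 0"
  obtains B where "0 \<le> B"
    "\<And>y. (\<Sum>a<n. (y a)\<^sup>2) \<le> B * (\<Sum>i<N. \<Sum>a<n. (y a - (\<Sum>b<n. P i a b * y b))\<^sup>2)"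
proof -
  define M where "M a b = (\<Sum>i<N. (if a = b then 1 else 0) - P i a b)" for a b
  have M: "(\<Sum>b<n. M a b * y b) = (\<Sum>i<N. y a - (\<Sum>b<n. P i a b * y b))" if "a < n" for a y
  proof -
    have "(\<Sum>b<n. M a b * y b) = (\<Sum>i<N. \<Sum>b<n. ((if a = b then 1 else 0) - P i a b) * y b)"
      unfolding M_def sum_distrib_right by (rule sum.swap)
    also have "\<dots> = (\<Sum>i<N. y a - (\<Sum>b<n. P i a b * y b))"
      using that by (simp add: left_diff_distrib sum_subtractf if_distrib[of "\<lambda>x. x * _"] cong: if_cong)
    finally show ?thesis .
  qed
  have form: "(\<Sum>a<n. (y a - (\<Sum>b<n. P i a b * y b))\<^sup>2) = (\<Sum>a<n. y a * (y a - (\<Sum>b<n. P i a b * y b)))"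
    if i: "i < N" for i y
  proof -
    let ?p = "\<lambda>a. \<Sum>b<n. P i a b * y b"
    have "(\<Sum>a<n. (?p a)\<^sup>2) = (\<Sum>a<n. \<Sum>b<n. \<Sum>c<n. y b * y c * (P i a b * P i a c))"
      by (simp add: power2_eq_square sum_product mult_ac)
    also have "\<dots> = (\<Sum>b<n. \<Sum>a<n. \<Sum>c<n. y b * y c * (P i a b * P i a c))" by (rule sum.swap)
    also have "\<dots> = (\<Sum>b<n. \<Sum>c<n. \<Sum>a<n. y b * y c * (P i a b * P i a c))"
      by (intro sum.cong refl sum.swap)
    also have "\<dots> = (\<Sum>b<n. \<Sum>c<n. y b * y c * P i b c)"
      using proj[OF i] by (simp add: sum_distrib_left[symmetric])
    also have "\<dots> = (\<Sum>a<n. y a * ?p a)" by (simp add: sum_distrib_left mult_ac)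
    finally have p: "(\<Sum>a<n. (?p a)\<^sup>2) = (\<Sum>a<n. y a * ?p a)" .
    have "(\<Sum>a<n. (y a - ?p a)\<^sup>2) = (\<Sum>a<n. y a * (y a - ?p a) - y a * ?p a + (?p a)\<^sup>2)"
      by (intro sum.cong refl) (simp add: power2_eq_square algebra_simps)
    also have "\<dots> = (\<Sum>a<n. y a * (y a - ?p a)) - (\<Sum>a<n. y a * ?p a) + (\<Sum>a<n. (?p a)\<^sup>2)"
      by (simp only: sum.distrib sum_subtractf)
    finally show ?thesis using p by simp
  qed
  have "\<exists>B\<ge>0. \<forall>y. (\<Sum>a<n. (y a)\<^sup>2) \<le> B * (\<Sum>a<n. (\<Sum>b<n. M a b * y b)\<^sup>2)"
  proof (rule injective_matrix_bounded_below[of n M])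
    fix y a assume zero: "\<And>a. a < n \<Longrightarrow> (\<Sum>b<n. M a b * y b) = 0" and a: "a < n"
    let ?q = "\<lambda>i a. y a - (\<Sum>b<n. P i a b * y b)"
    have "(\<Sum>i<N. \<Sum>a<n. (?q i a)\<^sup>2) = (\<Sum>i<N. \<Sum>a<n. y a * ?q i a)"
      using form by simp
    also have "\<dots> = (\<Sum>a<n. y a * (\<Sum>i<N. ?q i a))"
      by (subst sum.swap) (simp add: sum_distrib_left)
    also have "\<dots> = 0" using M zero by simp
    finally have "(\<Sum>i<N. \<Sum>a<n. (?q i a)\<^sup>2) = 0" .
    then have "\<forall>i\<in>{..<N}. (\<Sum>a<n. (?q i a)\<^sup>2) = 0"
      by (subst (asm) sum_nonneg_eq_0_iff) (auto intro: sum_nonneg)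
    then have "(\<Sum>a<n. (?q i a)\<^sup>2) = 0" if "i < N" for i using that by blast
    then have "\<forall>a\<in>{..<n}. (?q i a)\<^sup>2 = 0" if "i < N" for i
      using that by (subst sum_nonneg_eq_0_iff[symmetric]) auto
    then have "(?q i a)\<^sup>2 = 0" if "i < N" "a < n" for i a
      using that by blast
    then have "?q i a = 0" if "i < N" "a < n" for i a
      using that by (simp only: zero_eq_power2)
    then have "(\<Sum>b<n. P i a b * y b) = y a" if "i < N" "a < n" for i a
      using that by (metis eq_iff_diff_eq_0)
    then show "y a = 0" using triv a by blast
  qed blast
  then obtain B where B: "0 \<le> B" "\<And>y. (\<Sum>a<n. (y a)\<^sup>2) \<le> B * (\<Sum>a<n. (\<Sum>b<n. M a b * y b)\<^sup>2)"
    by blast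
  show thesis
  proof (rule that[of "B * real N"])
    show "0 \<le> B * real N" using B by simp
    fix y :: "nat \<Rightarrow> real"
    let ?q = "\<lambda>i a. y a - (\<Sum>b<n. P i a b * y b)"
    have "(\<Sum>a<n. (y a)\<^sup>2) \<le> B * (\<Sum>a<n. (\<Sum>b<n. M a b * y b)\<^sup>2)" by (rule B(2))
    also have "\<dots> = B * (\<Sum>a<n. (\<Sum>i<N. ?q i a)\<^sup>2)" using M by simp
    also have "\<dots> \<le> B * (\<Sum>a<n. real N * (\<Sum>i<N. (?q i a)\<^sup>2))"
    proof (intro mult_left_mono sum_mono B(1))
      show "(\<Sum>i<N. ?q i a)\<^sup>2 \<le> real N * (\<Sum>i<N. (?q i a)\<^sup>2)" for a
        using sum_mult_power2_le[of "\<lambda>_. 1" "\<lambda>i. ?q i a" "{..<N}"] by simp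
    qed
    also have "(\<Sum>a<n. real N * (\<Sum>i<N. (?q i a)\<^sup>2)) = real N * (\<Sum>i<N. \<Sum>a<n. (?q i a)\<^sup>2)"
      by (subst sum.swap) (simp only: sum_distrib_left[symmetric])
    finally show "(\<Sum>a<n. (y a)\<^sup>2) \<le> B * real N * (\<Sum>i<N. \<Sum>a<n. (?q i a)\<^sup>2)" by (simp add: mult.assoc)
  qed
qed

section \<open>Block-diagonal matrices in node coordinates\<close>

lemma diag_block_mat_carrier:
  assumes "\<And>x. x \<in> set xs \<Longrightarrow> f x \<in> carrier_mat (r x) (c x)"
  shows "diag_block_mat (map f xs) \<in> carrier_mat (\<Sum>x\<leftarrow>xs. r x) (\<Sum>x\<leftarrow>xs. c x)"
proof (rule carrier_matI)
  have "map dim_row (map f xs) = map r xs" "map dim_col (map f xs) = map c xs"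
    by (simp_all add: carrier_matD[OF assms])
  then show "dim_row (diag_block_mat (map f xs)) = (\<Sum>x\<leftarrow>xs. r x)"
    "dim_col (diag_block_mat (map f xs)) = (\<Sum>x\<leftarrow>xs. c x)"
    by (simp_all only: dim_diag_block_mat simp_thms)
qed

lemma diag_block_mat_mult:
  fixes f g :: "'b \<Rightarrow> 'a :: semiring_1 mat"
  assumes "\<And>x. x \<in> set xs \<Longrightarrow> f x \<in> carrier_mat (r x) (c x)"
    and "\<And>x. x \<in> set xs \<Longrightarrow> g x \<in> carrier_mat (c x) (d x)"
  shows "diag_block_mat (map f xs) * diag_block_mat (map g xs) = diag_block_mat (map (\<lambda>x. f x * g x) xs)"
  using assms
proof (induction xs)
  case Nil
  show ?case by (rule eq_matI) auto
next
  case (Cons x xs)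
  let ?F = "diag_block_mat (map f xs)" and ?G = "diag_block_mat (map g xs)"
  have f: "f x \<in> carrier_mat (r x) (c x)" and g: "g x \<in> carrier_mat (c x) (d x)"
    using Cons.prems by auto
  have F: "?F \<in> carrier_mat (\<Sum>x\<leftarrow>xs. r x) (\<Sum>x\<leftarrow>xs. c x)"
    by (rule diag_block_mat_carrier) (use Cons.prems in auto)
  have G: "?G \<in> carrier_mat (\<Sum>x\<leftarrow>xs. c x) (\<Sum>x\<leftarrow>xs. d x)"
    by (rule diag_block_mat_carrier) (use Cons.prems in auto)
  have IH: "?F * ?G = diag_block_mat (map (\<lambda>x. f x * g x) xs)"
    by (rule Cons.IH) (use Cons.prems in auto)
  have dims: "dim_row (f x) = r x" "dim_col (f x) = c x" "dim_row (g x) = c x" "dim_col (g x) = d x"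
    "dim_row ?F = (\<Sum>x\<leftarrow>xs. r x)" "dim_col ?F = (\<Sum>x\<leftarrow>xs. c x)"
    "dim_row ?G = (\<Sum>x\<leftarrow>xs. c x)" "dim_col ?G = (\<Sum>x\<leftarrow>xs. d x)"
    using f g F G by auto
  show ?case
    unfolding list.map diag_block_mat.simps Let_def IH[symmetric] dims
    by (subst mult_four_block_mat[OF f _ _ F g _ _ G]) (use f g F G dims in auto)
qed

lemma diag_block_mat_transpose:
  "(diag_block_mat Xs)\<^sup>T = diag_block_mat (map transpose_mat Xs)"
proof (induction Xs)
  case (Cons X Xs)
  have "(four_block_mat X (0\<^sub>m (dim_row X) (dim_col (diag_block_mat Xs)))
      (0\<^sub>m (dim_row (diag_block_mat Xs)) (dim_col X)) (diag_block_mat Xs))\<^sup>T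
    = four_block_mat X\<^sup>T (0\<^sub>m (dim_row (diag_block_mat Xs)) (dim_col X))\<^sup>T
      (0\<^sub>m (dim_row X) (dim_col (diag_block_mat Xs)))\<^sup>T (diag_block_mat Xs)\<^sup>T"
    by (rule transpose_four_block_mat) auto
  then show ?case by (simp add: Let_def Cons.IH[symmetric])
qed (auto intro!: eq_matI)

lemma block_index_less: "i * n + a < N * n" if "i < N" "a < (n :: nat)"
proof -
  have "i * n + a < Suc i * n" using that by simp
  also have "\<dots> \<le> N * n" using that by (intro mult_right_mono) auto
  finally show ?thesis .
qed

text \<open>Induction on the number of blocks peels off the first one, which shifts the family of blocks by one.\<close>

lemma diag_block_mat_index:
  assumes "\<And>i. i < N \<Longrightarrow> B i \<in> carrier_mat n n" "i < N" "j < N" "a < n" "b < n"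
  shows "diag_block_mat (map B [0..<N]) $$ (i * n + a, j * n + b) = (if i = j then B i $$ (a, b) else 0)"
  using assms
proof (induction N arbitrary: B i j)
  case (Suc N)
  let ?R = "diag_block_mat (map (\<lambda>i. B (Suc i)) [0..<N])"
  have B0: "B 0 \<in> carrier_mat n n" using Suc.prems by simp
  have "?R \<in> carrier_mat (\<Sum>x\<leftarrow>[0..<N]. n) (\<Sum>x\<leftarrow>[0..<N]. n)"
    by (rule diag_block_mat_carrier) (use Suc.prems in auto)
  then have R: "?R \<in> carrier_mat (N * n) (N * n)" by (simp add: sum_list_triv)
  have "map B [0..<Suc N] = B 0 # map (\<lambda>i. B (Suc i)) [0..<N]"
    by (simp add: upt_conv_Cons map_Suc_upt[symmetric] del: upt_Suc)
  then have eq: "diag_block_mat (map B [0..<Suc N]) = four_block_mat (B 0) (0\<^sub>m n (N * n)) (0\<^sub>m (N * n) n) ?R"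
    using B0 R by (simp add: Let_def del: upt_Suc)
  have IH: "?R $$ (i' * n + a, j' * n + b) = (if i' = j' then B (Suc i') $$ (a, b) else 0)"
    if "i' < N" "j' < N" for i' j'
    by (rule Suc.IH) (use Suc.prems that in auto)
  have less: "i' * n + a < N * n" "i' * n + b < N * n" if "i' < N" for i'
    using block_index_less[OF that] Suc.prems by auto
  show ?case
    unfolding eq using Suc.prems(2-5) less
    by (cases i; cases j)
      (simp_all add: index_mat_four_block carrier_matD[OF B0] carrier_matD[OF R] IH add.assoc)
qed simp

lemma sum_blocks: "(\<Sum>r<N * n. f r) = (\<Sum>i<N. \<Sum>a<n. f (i * n + a))" for f :: "nat \<Rightarrow> real"
proof -
  have "sum f {i * n..<i * n + n} = (\<Sum>a<n. f (i * n + a))" for i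
    using sum.shift_bounds_nat_ivl[of f 0 "i * n" n] by (simp add: add.commute lessThan_atLeast0)
  then show ?thesis using sum.nat_group[of f n N] by simp
qed

lemma diag_block_mat_mult_vec_index:
  assumes B: "\<And>i. i < N \<Longrightarrow> B i \<in> carrier_mat n n" and X: "X \<in> carrier_vec (N * n)"
    and "i < N" "a < n"
  shows "(diag_block_mat (map B [0..<N]) *\<^sub>v X) $ (i * n + a) = (\<Sum>b<n. B i $$ (a, b) * X $ (i * n + b) :: real)"
proof -
  let ?D = "diag_block_mat (map B [0..<N])"
  have "?D \<in> carrier_mat (\<Sum>x\<leftarrow>[0..<N]. n) (\<Sum>x\<leftarrow>[0..<N]. n)"
    by (rule diag_block_mat_carrier) (use B in auto)
  then have D: "?D \<in> carrier_mat (N * n) (N * n)" by (simp add: sum_list_triv)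
  have ia: "i * n + a < N * n" using block_index_less assms by simp
  have "(?D *\<^sub>v X) $ (i * n + a) = (\<Sum>r<N * n. ?D $$ (i * n + a, r) * X $ r)"
    by (rule mult_mat_vec_index_sum[OF D X ia])
  also have "\<dots> = (\<Sum>j<N. \<Sum>b<n. ?D $$ (i * n + a, j * n + b) * X $ (j * n + b))"
    by (rule sum_blocks)
  also have "\<dots> = (\<Sum>j<N. if j = i then \<Sum>b<n. B i $$ (a, b) * X $ (i * n + b) else 0)"
    using assms by (intro sum.cong refl) (auto simp: diag_block_mat_index[OF B])
  also have "\<dots> = (\<Sum>b<n. B i $$ (a, b) * X $ (i * n + b))" using \<open>i < N\<close> by simp
  finally show ?thesis .
qed

lemma kronecker_one_mult_vec_index:
  assumes L: "L \<in> carrier_mat N N" and X: "X \<in> carrier_vec (N * n)" and "i < N" "a < n"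
  shows "(kronecker L (1\<^sub>m n) *\<^sub>v X) $ (i * n + a) = (\<Sum>j<N. L $$ (i, j) * X $ (j * n + a) :: real)"
proof -
  let ?D = "kronecker L (1\<^sub>m n)"
  have D: "?D \<in> carrier_mat (N * n) (N * n)" using L by (simp add: kronecker_def)
  have ia: "i * n + a < N * n" using block_index_less assms by simp
  have entry: "?D $$ (i * n + a, j * n + b) = (if b = a then L $$ (i, j) else 0)" if "j < N" "b < n" for j b
    using that assms ia block_index_less[OF that] L by (auto simp: kronecker_def)
  have "(?D *\<^sub>v X) $ (i * n + a) = (\<Sum>r<N * n. ?D $$ (i * n + a, r) * X $ r)"
    by (rule mult_mat_vec_index_sum[OF D X ia])
  also have "\<dots> = (\<Sum>j<N. \<Sum>b<n. ?D $$ (i * n + a, j * n + b) * X $ (j * n + b))"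
    by (rule sum_blocks)
  also have "\<dots> = (\<Sum>j<N. \<Sum>b<n. if b = a then L $$ (i, j) * X $ (j * n + a) else 0)"
    by (intro sum.cong refl) (auto simp: entry)
  also have "\<dots> = (\<Sum>j<N. L $$ (i, j) * X $ (j * n + a))" using \<open>a < n\<close> by simp
  finally show ?thesis .
qed

text \<open>The zero diagonal of \<open>W\<close> is needed since \<open>laplacian\<close> puts the full row sum on its diagonal and drops the
  entry \<open>W $$ (i, i)\<close> itself.\<close>

lemma laplacian_row:
  fixes y :: "nat \<Rightarrow> real"
  assumes "W \<in> carrier_mat N N" "W $$ (i, i) = 0" "i < N"
  shows "(\<Sum>j<N. laplacian W $$ (i, j) * y j) = (\<Sum>j<N. W $$ (i, j) * (y i - y j))"
proof -
  have "(\<Sum>j<N. laplacian W $$ (i, j) * y j)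
    = (\<Sum>j<N. (if j = i then (\<Sum>k<N. W $$ (i, k)) * y i else 0) - W $$ (i, j) * y j)"
    using assms by (intro sum.cong refl) (auto simp: laplacian_def)
  also have "\<dots> = (\<Sum>k<N. W $$ (i, k)) * y i - (\<Sum>j<N. W $$ (i, j) * y j)"
    using assms by (simp add: sum_subtractf)
  finally show ?thesis by (simp add: sum_distrib_right right_diff_distrib sum_subtractf)
qed

definition block_entry :: "nat \<Rightarrow> real vec \<Rightarrow> nat \<Rightarrow> nat \<Rightarrow> real" where
  "block_entry n X i a = X $ (i * n + a)"

text \<open>With \<open>X = U v\<close>, the matrix of the system becomes a node-wise drift and a projected coupling: \<open>U A\<^sub>o = diag(A) U\<close>
  by invariance, and \<open>U \<Gamma> U\<^sup>T\<close> is block diagonal with blocks \<open>\<gamma>\<^sub>i U\<^sub>i U\<^sub>i\<^sup>T\<close>. The Kronecker product with the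
  identity acts on the node index alone.\<close>

lemma network_matrix_in_node_coordinates:
  fixes A :: "real mat" and U :: "nat \<Rightarrow> real mat" and \<gamma> :: "nat \<Rightarrow> real"
  assumes A: "A \<in> carrier_mat n n"
    and U: "\<And>i. i < N \<Longrightarrow> U i \<in> carrier_mat n (\<nu> i)"
    and inv: "\<And>i. i < N \<Longrightarrow> U i * unobservable_part A (U i) = A * U i"
    and W: "W \<in> carrier_mat N N" "\<And>i. i < N \<Longrightarrow> W $$ (i, i) = 0"
    and v: "v \<in> carrier_vec (\<Sum>i<N. \<nu> i)"
    and ia: "i < N" "a < n"
  defines "Ub \<equiv> diag_block_mat (map U [0..<N])"
    and "Ao \<equiv> diag_block_mat (map (\<lambda>i. unobservable_part A (U i)) [0..<N])"
    and "\<Gamma> \<equiv> diag_block_mat (map (\<lambda>i. \<gamma> i \<cdot>\<^sub>m 1\<^sub>m (\<nu> i)) [0..<N])"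
  shows "block_entry n (Ub *\<^sub>v ((Ao - \<Gamma> * Ub\<^sup>T * kronecker (laplacian W) (1\<^sub>m n) * Ub) *\<^sub>v v)) i a
    = (\<Sum>b<n. A $$ (a, b) * block_entry n (Ub *\<^sub>v v) i b)
      - coupling n N (\<lambda>i a b. (U i * (U i)\<^sup>T) $$ (a, b)) \<gamma> (\<lambda>i j. W $$ (i, j))
          (block_entry n (Ub *\<^sub>v v)) i a"
proof -
  let ?d = "\<Sum>i<N. \<nu> i" and ?K = "kronecker (laplacian W) (1\<^sub>m n)"
  let ?Ad = "diag_block_mat (map (\<lambda>_. A) [0..<N])"
  let ?Pd = "diag_block_mat (map (\<lambda>i. U i * (\<gamma> i \<cdot>\<^sub>m 1\<^sub>m (\<nu> i)) * (U i)\<^sup>T) [0..<N])"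
  have Ui: "U i \<in> carrier_mat n (\<nu> i)" if "i \<in> set [0..<N]" for i using U that by simp
  have UTi: "(U i)\<^sup>T \<in> carrier_mat (\<nu> i) n" if "i \<in> set [0..<N]" for i using Ui[OF that] by simp
  have Aoi: "unobservable_part A (U i) \<in> carrier_mat (\<nu> i) (\<nu> i)" if "i \<in> set [0..<N]" for i
    using Ui[OF that] UTi[OF that] A unfolding unobservable_part_def by (intro mult_carrier_mat)
  have \<Gamma>i: "\<gamma> i \<cdot>\<^sub>m 1\<^sub>m (\<nu> i) \<in> carrier_mat (\<nu> i) (\<nu> i)" for i by simp
  have U\<Gamma>i: "U i * (\<gamma> i \<cdot>\<^sub>m 1\<^sub>m (\<nu> i)) \<in> carrier_mat n (\<nu> i)" if "i \<in> set [0..<N]" for i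
    using Ui[OF that] by simp
  have sums: "(\<Sum>i\<leftarrow>[0..<N]. \<nu> i) = ?d" "(\<Sum>i\<leftarrow>[0..<N]. n) = N * n"
    by (simp_all add: interv_sum_list_conv_sum_set_nat lessThan_atLeast0 sum_list_triv)
  have Ub: "Ub \<in> carrier_mat (N * n) ?d"
    unfolding Ub_def sums[symmetric] by (rule diag_block_mat_carrier, rule Ui)
  have UbT: "Ub\<^sup>T \<in> carrier_mat ?d (N * n)" using Ub by simp
  have Ao: "Ao \<in> carrier_mat ?d ?d"
    unfolding Ao_def sums[symmetric] by (rule diag_block_mat_carrier, rule Aoi)
  have \<Gamma>: "\<Gamma> \<in> carrier_mat ?d ?d"
    unfolding \<Gamma>_def sums[symmetric] by (rule diag_block_mat_carrier, rule \<Gamma>i)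
  have L: "laplacian W \<in> carrier_mat N N" using W by (simp add: laplacian_def)
  have K: "?K \<in> carrier_mat (N * n) (N * n)" using L by (simp add: kronecker_def)
  have Ad: "?Ad \<in> carrier_mat (N * n) (N * n)"
    unfolding sums[symmetric] by (rule diag_block_mat_carrier, rule A)
  define X where "X = Ub *\<^sub>v v"
  have X: "X \<in> carrier_vec (N * n)" unfolding X_def using Ub by (intro carrier_vecI) simp
  have drift: "Ub * Ao = ?Ad * Ub"
  proof -
    have "Ub * Ao = diag_block_mat (map (\<lambda>i. U i * unobservable_part A (U i)) [0..<N])"
      unfolding Ub_def Ao_def by (rule diag_block_mat_mult[OF Ui Aoi])
    also have "\<dots> = diag_block_mat (map (\<lambda>i. A * U i) [0..<N])"
      using inv by (intro arg_cong[of _ _ diag_block_mat] map_cong refl) simp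
    also have "\<dots> = ?Ad * Ub"
      unfolding Ub_def by (rule diag_block_mat_mult[OF A Ui, symmetric])
    finally show ?thesis .
  qed
  have gain: "Ub * \<Gamma> * Ub\<^sup>T = ?Pd"
  proof -
    have "Ub * \<Gamma> = diag_block_mat (map (\<lambda>i. U i * (\<gamma> i \<cdot>\<^sub>m 1\<^sub>m (\<nu> i))) [0..<N])"
      unfolding Ub_def \<Gamma>_def by (rule diag_block_mat_mult[OF Ui \<Gamma>i])
    moreover have "Ub\<^sup>T = diag_block_mat (map (\<lambda>i. (U i)\<^sup>T) [0..<N])"
      unfolding Ub_def by (simp add: diag_block_mat_transpose comp_def)
    ultimately show ?thesis by (simp only: diag_block_mat_mult[OF U\<Gamma>i UTi])
  qed
  have "Ub *\<^sub>v ((Ao - \<Gamma> * Ub\<^sup>T * ?K * Ub) *\<^sub>v v)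
    = Ub *\<^sub>v (Ao *\<^sub>v v) - Ub *\<^sub>v (\<Gamma> *\<^sub>v (Ub\<^sup>T *\<^sub>v (?K *\<^sub>v X)))"
  proof -
    have 1: "\<Gamma> * Ub\<^sup>T \<in> carrier_mat ?d (N * n)" by (rule mult_carrier_mat[OF \<Gamma> UbT])
    have 2: "\<Gamma> * Ub\<^sup>T * ?K \<in> carrier_mat ?d (N * n)" by (rule mult_carrier_mat[OF 1 K])
    have 3: "\<Gamma> * Ub\<^sup>T * ?K * Ub \<in> carrier_mat ?d ?d" by (rule mult_carrier_mat[OF 2 Ub])
    have KX: "?K *\<^sub>v X \<in> carrier_vec (N * n)" by (rule mult_mat_vec_carrier[OF K X])
    have "(\<Gamma> * Ub\<^sup>T * ?K * Ub) *\<^sub>v v = \<Gamma> *\<^sub>v (Ub\<^sup>T *\<^sub>v (?K *\<^sub>v X))"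
      unfolding assoc_mult_mat_vec[OF 2 Ub v] X_def[symmetric] assoc_mult_mat_vec[OF 1 K X]
      by (rule assoc_mult_mat_vec[OF \<Gamma> UbT KX])
    then show ?thesis
      using minus_mult_distrib_mat_vec[OF Ao 3 v]
        mult_minus_distrib_mat_vec[OF Ub mult_mat_vec_carrier[OF Ao v] mult_mat_vec_carrier[OF 3 v]]
      by simp
  qed
  also have "Ub *\<^sub>v (Ao *\<^sub>v v) = ?Ad *\<^sub>v X"
    using assoc_mult_mat_vec[OF Ub Ao v] assoc_mult_mat_vec[OF Ad Ub v] drift X_def by simp
  also have "Ub *\<^sub>v (\<Gamma> *\<^sub>v (Ub\<^sup>T *\<^sub>v (?K *\<^sub>v X))) = ?Pd *\<^sub>v (?K *\<^sub>v X)"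
  proof -
    have KX: "?K *\<^sub>v X \<in> carrier_vec (N * n)" by (rule mult_mat_vec_carrier[OF K X])
    show ?thesis
      unfolding gain[symmetric] assoc_mult_mat_vec[OF mult_carrier_mat[OF Ub \<Gamma>] UbT KX]
      by (rule assoc_mult_mat_vec[OF Ub \<Gamma> mult_mat_vec_carrier[OF UbT KX], symmetric])
  qed
  finally have rhs: "Ub *\<^sub>v ((Ao - \<Gamma> * Ub\<^sup>T * ?K * Ub) *\<^sub>v v) = ?Ad *\<^sub>v X - ?Pd *\<^sub>v (?K *\<^sub>v X)" .
  have KX: "?K *\<^sub>v X \<in> carrier_vec (N * n)" by (rule mult_mat_vec_carrier[OF K X])
  have P: "U i * (\<gamma> i \<cdot>\<^sub>m 1\<^sub>m (\<nu> i)) * (U i)\<^sup>T = \<gamma> i \<cdot>\<^sub>m (U i * (U i)\<^sup>T)" if "i < N" for i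
    using U[OF that] by (simp add: mult_smult_distrib[of _ n "\<nu> i" _ "\<nu> i"] mult_smult_assoc_mat[of _ n "\<nu> i" _ n])
  have PPc: "U i * (\<gamma> i \<cdot>\<^sub>m 1\<^sub>m (\<nu> i)) * (U i)\<^sup>T \<in> carrier_mat n n" if "i < N" for i
    unfolding P[OF that] using U[OF that] by simp
  have Ad_entry: "(?Ad *\<^sub>v X) $ (i * n + a) = (\<Sum>b<n. A $$ (a, b) * X $ (i * n + b))"
    by (rule diag_block_mat_mult_vec_index[OF A X ia])
  have "(?Pd *\<^sub>v (?K *\<^sub>v X)) $ (i * n + a)
    = (\<Sum>b<n. (U i * (\<gamma> i \<cdot>\<^sub>m 1\<^sub>m (\<nu> i)) * (U i)\<^sup>T) $$ (a, b) * (?K *\<^sub>v X) $ (i * n + b))"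
    by (rule diag_block_mat_mult_vec_index[OF PPc KX ia])
  also have "\<dots> = (\<Sum>b<n. \<gamma> i * (U i * (U i)\<^sup>T) $$ (a, b)
      * (\<Sum>j<N. W $$ (i, j) * (X $ (i * n + b) - X $ (j * n + b))))"
  proof (intro sum.cong refl)
    fix b assume "b \<in> {..<n}"
    then have b: "b < n" by simp
    have "(?K *\<^sub>v X) $ (i * n + b) = (\<Sum>j<N. W $$ (i, j) * (X $ (i * n + b) - X $ (j * n + b)))"
      unfolding kronecker_one_mult_vec_index[OF L X ia(1) b]
      by (rule laplacian_row[OF W(1) W(2)[OF ia(1)] ia(1)])
    then show "(U i * (\<gamma> i \<cdot>\<^sub>m 1\<^sub>m (\<nu> i)) * (U i)\<^sup>T) $$ (a, b) * (?K *\<^sub>v X) $ (i * n + b)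
      = \<gamma> i * (U i * (U i)\<^sup>T) $$ (a, b)
      * (\<Sum>j<N. W $$ (i, j) * (X $ (i * n + b) - X $ (j * n + b)))"
      unfolding P[OF ia(1)] using U[OF ia(1)] ia b by simp
  qed
  also have "\<dots> = coupling n N (\<lambda>i a b. (U i * (U i)\<^sup>T) $$ (a, b)) \<gamma> (\<lambda>i j. W $$ (i, j)) (block_entry n X) i a"
    by (simp only: coupling_def block_entry_def sum_distrib_left[of "\<gamma> i"] mult.assoc)
  finally have Pd_entry: "(?Pd *\<^sub>v (?K *\<^sub>v X)) $ (i * n + a) = \<dots>" .
  have "dim_vec (?Pd *\<^sub>v (?K *\<^sub>v X)) = N * n"
    using gain Ub by (metis dim_mult_mat_vec index_mult_mat(2) carrier_matD(1))
  then show ?thesis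
    unfolding rhs X_def[symmetric] using Ad_entry Pd_entry block_index_less[OF ia]
    by (simp add: block_entry_def)
qed

section \<open>Exponential decay of projected consensus\<close>

lemma finite_positive_lower_bound:
  fixes S :: "real set"
  assumes "finite S" "\<And>x. x \<in> S \<Longrightarrow> 0 < x"
  obtains e where "0 < e" "\<And>x. x \<in> S \<Longrightarrow> e \<le> x"
proof (rule that[of "Min (insert 1 S)"])
  show "0 < Min (insert 1 S)" using assms by (subst Min_gr_iff) auto
  show "Min (insert 1 S) \<le> x" if "x \<in> S" for x using assms that by (intro Min_le) auto
qed

lemma edge_le_disagreement:
  assumes "\<And>i j. i < N \<Longrightarrow> j < N \<Longrightarrow> 0 \<le> w i j" "i < N" "j < N"
  shows "w i j * node_dist n x i j \<le> disagreement n N w x"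
proof -
  have "w i j * node_dist n x i j \<le> (\<Sum>j<N. w i j * node_dist n x i j)"
    by (rule member_le_sum[of j "{..<N}" "\<lambda>j. w i j * node_dist n x i j"])
      (use assms node_dist_nonneg in auto)
  also have "\<dots> \<le> disagreement n N w x"
    unfolding disagreement_def
    by (rule member_le_sum[of i "{..<N}" "\<lambda>i. \<Sum>j<N. w i j * node_dist n x i j"])
      (use assms node_dist_nonneg in \<open>auto intro!: sum_nonneg\<close>)
  finally show ?thesis .
qed

lemma disagreement_nonneg:
  assumes "\<And>i j. i < N \<Longrightarrow> j < N \<Longrightarrow> 0 \<le> w i j"
  shows "0 \<le> disagreement n N w x"
  unfolding disagreement_def using assms node_dist_nonneg by (intro sum_nonneg mult_nonneg_nonneg) auto

lemma DERIV_power2: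
  assumes "(f has_real_derivative f') (at s)"
  shows "((\<lambda>s. (f s)\<^sup>2) has_real_derivative 2 * f s * f') (at s)"
  using DERIV_power[OF assms, of 2] by (simp add: mult_ac)

text \<open>Solutions in node coordinates: \<open>x s i a\<close> is component \<open>a\<close> of the state of node \<open>i\<close> at time \<open>s\<close>, and \<open>S\<close>
  is the set of exceptional instants. The last clause confines node \<open>i\<close> to the range of \<open>P\<^sub>i\<close>.\<close>

definition node_trajectory ::
  "nat \<Rightarrow> nat \<Rightarrow> (nat \<Rightarrow> nat \<Rightarrow> real) \<Rightarrow> (nat \<Rightarrow> nat \<Rightarrow> nat \<Rightarrow> real) \<Rightarrow> (nat \<Rightarrow> real)
     \<Rightarrow> (real \<Rightarrow> nat \<Rightarrow> nat \<Rightarrow> real) \<Rightarrow> real set \<Rightarrow> (real \<Rightarrow> nat \<Rightarrow> nat \<Rightarrow> real) \<Rightarrow> bool" where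
  "node_trajectory n N A P \<gamma> w S x \<longleftrightarrow>
     (\<forall>i<N. \<forall>a<n. continuous_on {0..} (\<lambda>s. x s i a)) \<and>
     (\<forall>s>0. s \<notin> S \<longrightarrow> (\<forall>i<N. \<forall>a<n.
        ((\<lambda>r. x r i a) has_real_derivative
          (\<Sum>b<n. A a b * x s i b) - coupling n N P \<gamma> (w s) (x s) i a) (at s))) \<and>
     (\<forall>s\<ge>0. \<forall>i<N. \<forall>a<n. (\<Sum>b<n. P i a b * x s i b) = x s i a)"

text \<open>The constants are chosen before the trajectory, which makes the decay uniform. They exist because only finitely
  many graphs occur: the positive weights are bounded away from \<open>0\<close> by \<open>\<omega>\<close>, and all weights are bounded by
  \<open>\<beta>\<close>. If \<open>\<delta>\<close> is the energy lost over a window, then every disagreement at its beginning is at most \<open>Q * \<delta>\<close>,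
  hence the energy there is at most \<open>M * \<delta>\<close>, and the window contracts the energy by \<open>\<rho> = 1 - 1 / M\<close>.\<close>

lemma projected_consensus_decay:
  fixes A :: "nat \<Rightarrow> nat \<Rightarrow> real" and P :: "nat \<Rightarrow> nat \<Rightarrow> nat \<Rightarrow> real"
    and w :: "nat \<Rightarrow> nat \<Rightarrow> nat \<Rightarrow> real"
  assumes skew: "\<And>a b. a < n \<Longrightarrow> b < n \<Longrightarrow> A b a = - A a b"
    and proj: "\<And>i b c. i < N \<Longrightarrow> b < n \<Longrightarrow> c < n \<Longrightarrow> (\<Sum>a<n. P i a b * P i a c) = P i b c"
    and symP: "\<And>i a b. i < N \<Longrightarrow> a < n \<Longrightarrow> b < n \<Longrightarrow> P i b a = P i a b"
    and triv: "\<And>y. \<forall>i<N. \<forall>a<n. (\<Sum>b<n. P i a b * y b) = y a \<Longrightarrow> \<forall>a<n. y a = 0"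
    and \<gamma>: "\<And>i. i < N \<Longrightarrow> 0 < \<gamma> i"
    and w_sym: "\<And>p i j. p \<in> {1..n0} \<Longrightarrow> i < N \<Longrightarrow> j < N \<Longrightarrow> w p i j = w p j i"
    and w_nonneg: "\<And>p i j. p \<in> {1..n0} \<Longrightarrow> i < N \<Longrightarrow> j < N \<Longrightarrow> 0 \<le> w p i j"
    and arcs: "\<And>p i j. p \<in> {1..n0} \<Longrightarrow> (i, j) \<in> parcs (G p) \<Longrightarrow> i < N \<and> j < N"
    and w_pos: "\<And>p i j. p \<in> {1..n0} \<Longrightarrow> (i, j) \<in> parcs (G p) \<Longrightarrow> i \<noteq> j \<Longrightarrow> 0 < w p i j"
    and sw: "switching_signal n0 \<tau> t \<sigma>"
    and conn: "jointly_connected N G \<tau> t \<sigma>"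
  shows "\<exists>c>0. \<exists>l>0. \<forall>x. node_trajectory n N A P \<gamma> (\<lambda>s. w (\<sigma> s)) (range t) x \<longrightarrow>
    (\<forall>r\<ge>0. \<forall>s\<ge>r.
      (\<Sum>i<N. \<Sum>a<n. (x s i a)\<^sup>2) \<le> c * exp (- l * (s - r)) * (\<Sum>i<N. \<Sum>a<n. (x r i a)\<^sup>2))"
proof -
  have "0 < \<tau>" using sw by (simp add: switching_signal_def)
  have \<sigma>: "\<sigma> s \<in> {1..n0}" if "0 \<le> s" for s using sw that by (simp add: switching_signal_def)
  have t0: "0 \<le> t k" for k by (rule switching_instants_nonneg[OF sw])
  obtain q T where q: "t (q 0) = 0" "\<And>k. \<tau> \<le> t (q (Suc k)) - t (q k)"
      "\<And>k. t (q (Suc k)) - t (q k) \<le> T"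
      "\<And>k. Digraph_Component.connected (with_proj (union_graph N G t \<sigma> (t (q k)) (t (q (Suc k)))))"
    using conn unfolding jointly_connected_def by blast
  define weights where "weights = (\<lambda>(p, i, j). w p i j) ` ({1..n0} \<times> {..<N} \<times> {..<N})"
  have fin: "finite weights" unfolding weights_def by (intro finite_imageI finite_cartesian_product) auto
  have mem: "w p i j \<in> weights" if "p \<in> {1..n0}" "i < N" "j < N" for p i j
    unfolding weights_def using that by (intro image_eqI[of _ _ "(p, i, j)"]) auto
  obtain \<omega> where \<omega>: "0 < \<omega>" "\<And>x. x \<in> weights \<inter> {0<..} \<Longrightarrow> \<omega> \<le> x"
    by (rule finite_positive_lower_bound[of "weights \<inter> {0<..}"]) (use fin in auto)
  define \<beta> where "\<beta> = Max (insert 0 weights)"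
  have \<beta>: "w p i j \<le> \<beta>" if "p \<in> {1..n0}" "i < N" "j < N" for p i j
    unfolding \<beta>_def using fin mem[OF that] by (intro Max_ge) auto
  have "0 \<le> \<beta>" unfolding \<beta>_def using fin by (intro Max_ge) auto
  obtain c1 where c1: "0 < c1" "\<And>x. x \<in> (\<lambda>i. 1 / \<gamma> i) ` {..<N} \<Longrightarrow> c1 \<le> x"
    by (rule finite_positive_lower_bound[of "(\<lambda>i. 1 / \<gamma> i) ` {..<N}"]) (use \<gamma> in auto)
  define c2 where "c2 = Max (insert 1 ((\<lambda>i. 1 / \<gamma> i) ` {..<N}))"
  have c2: "1 / \<gamma> i \<le> c2" if "i < N" for i
    unfolding c2_def using that by (intro Max_ge) auto
  have "1 \<le> c2" unfolding c2_def by (intro Max_ge) auto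
  obtain B where B: "0 \<le> B"
    "\<And>y. (\<Sum>a<n. (y a)\<^sup>2) \<le> B * (\<Sum>i<N. \<Sum>a<n. (y a - (\<Sum>b<n. P i a b * y b))\<^sup>2)"
    by (rule distance_to_fixed_spaces[of N n P, OF proj triv that])
  define B' where "B' = B * (2 + 2 * (\<Sum>i<N. \<Sum>a<n. \<Sum>b<n. (P i a b)\<^sup>2))"
  have "0 \<le> B'" unfolding B'_def using B by (intro mult_nonneg_nonneg add_nonneg_nonneg sum_nonneg) auto
  define H where "H = (\<Sum>i<N. (\<gamma> i)\<^sup>2 * (\<Sum>a<n. \<Sum>b<n. (P i a b)\<^sup>2)) * (real N * \<beta>)"
  have "0 \<le> H" unfolding H_def using \<open>0 \<le> \<beta>\<close> by (intro mult_nonneg_nonneg sum_nonneg) auto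
  define Q where "Q = 4 ^ (N * N) * (exp T * (1 / (\<tau> * \<omega>) + 4 * H))"
  have "0 \<le> Q" unfolding Q_def using \<open>0 < \<tau>\<close> \<omega> \<open>0 \<le> H\<close> by simp
  (* The summand 2 guarantees that \<rho> is positive, so that its logarithm makes sense. *)
  define M where "M = c2 * B' * (real N * real N) * Q + 2"
  have "2 \<le> M" unfolding M_def using \<open>1 \<le> c2\<close> \<open>0 \<le> B'\<close> \<open>0 \<le> Q\<close> by simp
  define \<rho> where "\<rho> = 1 - 1 / M"
  have \<rho>: "0 < \<rho>" "\<rho> < 1" unfolding \<rho>_def using \<open>2 \<le> M\<close> by (auto simp: field_simps)
  have "0 < T" using q(2)[of 0] q(3)[of 0] \<open>0 < \<tau>\<close> by linarith
  have gain: "0 < c2 / (c1 * \<rho>)" using \<open>1 \<le> c2\<close> c1 \<rho> by simp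
  have rate: "0 < - ln \<rho> / (2 * T)" using \<rho> \<open>0 < T\<close> by (simp add: divide_neg_pos)
  show ?thesis
  proof (rule exI, rule conjI[OF gain], rule exI, rule conjI[OF rate], intro allI impI)
    fix x :: "real \<Rightarrow> nat \<Rightarrow> nat \<Rightarrow> real" and r s :: real
    assume traj: "node_trajectory n N A P \<gamma> (\<lambda>s. w (\<sigma> s)) (range t) x" and rs: "0 \<le> r" "r \<le> s"
    have cont: "\<And>i a. i < N \<Longrightarrow> a < n \<Longrightarrow> continuous_on {0..} (\<lambda>s. x s i a)"
      and dx: "\<And>s i a. 0 < s \<Longrightarrow> s \<notin> range t \<Longrightarrow> i < N \<Longrightarrow> a < n \<Longrightarrow>
        ((\<lambda>r. x r i a) has_real_derivative
          (\<Sum>b<n. A a b * x s i b) - coupling n N P \<gamma> (w (\<sigma> s)) (x s) i a) (at s)"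
      and fixed: "\<And>s i a. 0 \<le> s \<Longrightarrow> i < N \<Longrightarrow> a < n \<Longrightarrow> (\<Sum>b<n. P i a b * x s i b) = x s i a"
      using traj unfolding node_trajectory_def by blast+
    define V where "V s = (\<Sum>i<N. 1 / \<gamma> i * (\<Sum>a<n. (x s i a)\<^sup>2))" for s
    define g where "g s = disagreement n N (w (\<sigma> s)) (x s)" for s
    define D where "D i j s = node_dist n (x s) i j" for i j s
    have contV: "continuous_on {0..} V"
      unfolding V_def by (intro continuous_intros cont) auto
    have contD: "continuous_on {0..} (D i j)" if "i < N" "j < N" for i j
      unfolding D_def node_dist_def by (intro continuous_intros cont that) auto
    have g_nonneg: "0 \<le> g s" if "0 < s" for s
      unfolding g_def using w_nonneg \<sigma> that by (intro disagreement_nonneg) auto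
    have dV: "(V has_real_derivative - g s) (at s)" if s: "0 < s" "s \<notin> range t" for s
    proof -
      let ?x' = "\<lambda>i a. (\<Sum>b<n. A a b * x s i b) - coupling n N P \<gamma> (w (\<sigma> s)) (x s) i a"
      have "((\<lambda>s. (x s i a)\<^sup>2) has_real_derivative 2 * x s i a * ?x' i a) (at s)" if "i < N" "a < n" for i a
        by (rule DERIV_power2[OF dx[OF s that]])
      then have "(V has_real_derivative (\<Sum>i<N. 1 / \<gamma> i * (\<Sum>a<n. 2 * x s i a * ?x' i a))) (at s)"
        unfolding V_def by (intro DERIV_sum DERIV_cmult) auto
      also have "(\<Sum>i<N. 1 / \<gamma> i * (\<Sum>a<n. 2 * x s i a * ?x' i a)) = - g s"
        unfolding g_def
      proof (rule energy_rate)
        show "(\<Sum>a<n. x s i a * P i a b) = x s i b" if "i < N" "b < n" for i b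
        proof -
          have "(\<Sum>a<n. x s i a * P i a b) = (\<Sum>a<n. P i b a * x s i a)"
            by (intro sum.cong refl) (simp add: symP[OF that(1), of b] that)
          then show ?thesis using fixed[of s i b] s that by simp
        qed
        show "A b a = - A a b" if "a < n" "b < n" for a b by (rule skew[OF that])
        show "w (\<sigma> s) i j = w (\<sigma> s) j i" if "i < N" "j < N" for i j
          by (rule w_sym[OF \<sigma> that]) (use s in simp)
      qed (rule \<gamma>)
      finally show ?thesis .
    qed
    have dD: "\<exists>y. (D i j has_real_derivative y) (at s) \<and> - (D i j s + (4 * H) * g s) \<le> y"
      if ij: "i < N" "j < N" and s: "0 < s" "s \<notin> range t" for i j s
    proof -
      let ?h = "coupling n N P \<gamma> (w (\<sigma> s)) (x s)"
      let ?x' = "\<lambda>i a. (\<Sum>b<n. A a b * x s i b) - ?h i a"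
      have "((\<lambda>s. (x s i a - x s j a)\<^sup>2) has_real_derivative 2 * (x s i a - x s j a) * (?x' i a - ?x' j a)) (at s)"
        if "a < n" for a
        by (rule DERIV_power2[OF DERIV_diff[OF dx[OF s ij(1) that] dx[OF s ij(2) that]]])
      then have deriv: "(D i j has_real_derivative
          (\<Sum>a<n. 2 * (x s i a - x s j a) * (?x' i a - ?x' j a))) (at s)"
        unfolding D_def node_dist_def by (intro DERIV_sum) auto
      have h: "(\<Sum>a<n. (?h i a)\<^sup>2) \<le> H * g s" if "i < N" for i
        unfolding H_def g_def using w_nonneg \<beta> \<sigma>[of s] s that by (intro coupling_bound) auto
      have "- (D i j s + 4 * (H * g s)) \<le> (\<Sum>a<n. 2 * (x s i a - x s j a) * (?x' i a - ?x' j a))"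
        unfolding D_def by (rule node_dist_rate[OF skew h[OF ij(1)] h[OF ij(2)]])
      then show ?thesis using deriv by (auto simp: mult.assoc)
    qed
    have edge: "\<omega> * D i j s \<le> g s"
      if "(i, j) \<in> parcs (G (\<sigma> s))" "0 < s" for i j s
    proof (cases "i = j")
      case True
      then show ?thesis using g_nonneg that by (simp add: D_def node_dist_def)
    next
      case False
      have p: "\<sigma> s \<in> {1..n0}" using \<sigma> that by simp
      have ij: "i < N" "j < N" using arcs[OF p that(1)] by auto
      have "\<omega> \<le> w (\<sigma> s) i j" using w_pos[OF p that(1) False] mem[OF p ij] by (intro \<omega>(2)) simp
      then have "\<omega> * D i j s \<le> w (\<sigma> s) i j * D i j s"
        unfolding D_def by (intro mult_right_mono node_dist_nonneg)
      also have "\<dots> \<le> g s"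
        unfolding D_def g_def by (intro edge_le_disagreement w_nonneg p ij)
      finally show ?thesis .
    qed
    have V_antimono: "V v \<le> V u" if "0 \<le> u" "u \<le> v" for u v
      by (rule dissipated_energy_antimono[OF sw contV dV g_nonneg that])
    have V_nonneg: "0 \<le> V s" for s
      unfolding V_def using \<gamma> by (intro sum_nonneg mult_nonneg_nonneg) (auto simp: order_less_imp_le)
    have V_upper: "V s \<le> c2 * (\<Sum>i<N. \<Sum>a<n. (x s i a)\<^sup>2)" for s
      unfolding V_def sum_distrib_left[of c2 _ "{..<N}"]
      by (intro sum_mono mult_right_mono c2 sum_nonneg) auto
    have V_lower: "c1 * (\<Sum>i<N. \<Sum>a<n. (x s i a)\<^sup>2) \<le> V s" for s
      unfolding V_def sum_distrib_left[of c1 _ "{..<N}"]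
      by (intro sum_mono mult_right_mono c1 sum_nonneg) auto
    have "V (t (q (Suc k))) \<le> \<rho> * V (t (q k))" for k
    proof -
      define \<delta> where "\<delta> = V (t (q k)) - V (t (q (Suc k)))"
      have le: "t (q k) \<le> t (q (Suc k))" using q(2)[of k] \<open>0 < \<tau>\<close> by simp
      have "0 \<le> \<delta>" unfolding \<delta>_def using V_antimono[OF t0 le] by simp
      have DQ: "D i j (t (q k)) \<le> Q * \<delta>" if "i < N" "j < N" for i j
      proof -
        have "D i j (t (q k)) \<le> 4 ^ (N * N) * (exp T * (1 / (\<tau> * \<omega>) + 4 * H) * (V (t (q k)) - V (t (q (Suc k)))))"
        proof (rule dissipation_over_connected_window[where D = D and g = g and V = V,
              OF sw le q(3) q(4) _ contV dV contD dD])
          show "i < N \<and> j < N" if "(i, j) \<in> parcs (G (\<sigma> (t l)))" for i j l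
            using arcs[OF \<sigma>[OF t0] that] .
          show "D i k s \<le> 2 * D i j s + 2 * D j k s" for i j k s
            unfolding D_def node_dist_def by (rule sum_diff_power2_le)
          show "D i j s = D j i s" for i j s
            by (simp add: D_def node_dist_def power2_commute)
        qed (use that g_nonneg edge \<open>0 \<le> H\<close> \<omega>(1) node_dist_nonneg in \<open>auto simp: D_def node_dist_def[of _ _ i i for i]\<close>)
        then show ?thesis by (simp add: Q_def \<delta>_def mult.assoc)
      qed
      have "(\<Sum>a<n. (x (t (q k)) j a)\<^sup>2) \<le> B' * (real N * (Q * \<delta>))" if "j < N" for j
      proof -
        have "(\<Sum>a<n. (x (t (q k)) j a)\<^sup>2) \<le> B' * (\<Sum>i<N. D i j (t (q k)))"
          unfolding B'_def D_def using B fixed[OF t0] that by (intro energy_le_node_dist) auto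
        also have "\<dots> \<le> B' * (\<Sum>i<N. Q * \<delta>)"
          using DQ that \<open>0 \<le> B'\<close> by (intro mult_left_mono sum_mono) auto
        finally show ?thesis by simp
      qed
      then have "(\<Sum>j<N. \<Sum>a<n. (x (t (q k)) j a)\<^sup>2) \<le> (\<Sum>j<N. B' * (real N * (Q * \<delta>)))"
        by (intro sum_mono) auto
      then have "c2 * (\<Sum>j<N. \<Sum>a<n. (x (t (q k)) j a)\<^sup>2) \<le> c2 * (\<Sum>j<N. B' * (real N * (Q * \<delta>)))"
        using \<open>1 \<le> c2\<close> by (intro mult_left_mono) auto
      then have "V (t (q k)) \<le> c2 * (\<Sum>j<N. B' * (real N * (Q * \<delta>)))"
        using V_upper[of "t (q k)"] by linarith
      also have "\<dots> \<le> M * \<delta>" unfolding M_def using \<open>0 \<le> \<delta>\<close> by (simp add: algebra_simps)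
      finally have "V (t (q k)) / M \<le> \<delta>" using \<open>2 \<le> M\<close> by (simp add: field_simps)
      then show ?thesis unfolding \<rho>_def \<delta>_def by (simp add: algebra_simps)
    qed
    then have decay: "V s \<le> 1 / \<rho> * exp (ln \<rho> / (2 * T) * (s - r)) * V r"
      by (intro exponential_decay_of_window_contraction[where u = "\<lambda>k. t (q k)", OF V_nonneg V_antimono])
        (use q \<open>0 < \<tau>\<close> \<rho> rs in auto)
    have "c1 * (\<Sum>i<N. \<Sum>a<n. (x s i a)\<^sup>2)
      \<le> 1 / \<rho> * exp (ln \<rho> / (2 * T) * (s - r)) * (c2 * (\<Sum>i<N. \<Sum>a<n. (x r i a)\<^sup>2))"
      using order_trans[OF V_lower decay] mult_left_mono[OF V_upper, of "1 / \<rho> * exp (ln \<rho> / (2 * T) * (s - r))" r] \<rho>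
      by (meson divide_nonneg_pos exp_ge_zero mult_nonneg_nonneg order_trans zero_le_one)
    then show "(\<Sum>i<N. \<Sum>a<n. (x s i a)\<^sup>2)
      \<le> c2 / (c1 * \<rho>) * exp (- (- ln \<rho> / (2 * T)) * (s - r)) * (\<Sum>i<N. \<Sum>a<n. (x r i a)\<^sup>2)"
      using c1 \<rho> by (simp add: field_simps)
  qed
qed

section \<open>Exponential stability of the switched system\<close>

lemma orthonormal_projection_matrix:
  assumes U: "U \<in> carrier_mat n d" and one: "U\<^sup>T * U = (1\<^sub>m d :: real mat)"
  shows "(U * U\<^sup>T)\<^sup>T = U * U\<^sup>T" and "U * U\<^sup>T * U = U" and "U * U\<^sup>T * (U * U\<^sup>T) = U * U\<^sup>T"
proof -
  have UT: "U\<^sup>T \<in> carrier_mat d n" using U by simp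
  show "(U * U\<^sup>T)\<^sup>T = U * U\<^sup>T" using transpose_mult[OF U UT] by simp
  show range: "U * U\<^sup>T * U = U"
    using assoc_mult_mat[OF U UT U] one U by simp
  show "U * U\<^sup>T * (U * U\<^sup>T) = U * U\<^sup>T"
    using assoc_mult_mat[OF mult_carrier_mat[OF U UT] U UT] range by simp
qed

text \<open>The passage from the stacked state \<open>v\<close> to node coordinates preserves the norm and lands, node by node, in the
  range of the projection \<open>U\<^sub>i U\<^sub>i\<^sup>T\<close>.\<close>

lemma block_diagonal_isometry:
  assumes U: "\<And>i. i < N \<Longrightarrow> U i \<in> carrier_mat n (\<nu> i)"
    and one: "\<And>i. i < N \<Longrightarrow> (U i)\<^sup>T * U i = (1\<^sub>m (\<nu> i) :: real mat)"
    and v: "v \<in> carrier_vec (\<Sum>i<N. \<nu> i)"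
  defines "X \<equiv> diag_block_mat (map U [0..<N]) *\<^sub>v v"
  shows block_diagonal_isometry_norm: "(\<Sum>i<N. \<Sum>a<n. (block_entry n X i a)\<^sup>2) = v \<bullet> v"
    and block_diagonal_isometry_range: "i < N \<Longrightarrow> a < n \<Longrightarrow>
      (\<Sum>b<n. (U i * (U i)\<^sup>T) $$ (a, b) * block_entry n X i b) = block_entry n X i a"
proof -
  let ?d = "\<Sum>i<N. \<nu> i" and ?Ub = "diag_block_mat (map U [0..<N])"
  have Ui: "U i \<in> carrier_mat n (\<nu> i)" if "i \<in> set [0..<N]" for i using U that by simp
  have UTi: "(U i)\<^sup>T \<in> carrier_mat (\<nu> i) n" if "i \<in> set [0..<N]" for i using Ui[OF that] by simp
  have Pi: "U i * (U i)\<^sup>T \<in> carrier_mat n n" if "i \<in> set [0..<N]" for i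
    using Ui[OF that] UTi[OF that] by (rule mult_carrier_mat)
  have sums: "(\<Sum>i\<leftarrow>[0..<N]. \<nu> i) = ?d" "(\<Sum>i\<leftarrow>[0..<N]. n) = N * n"
    by (simp_all add: interv_sum_list_conv_sum_set_nat lessThan_atLeast0 sum_list_triv)
  have Ub: "?Ub \<in> carrier_mat (N * n) ?d"
    unfolding sums[symmetric] by (rule diag_block_mat_carrier, rule Ui)
  have UbT: "?Ub\<^sup>T \<in> carrier_mat ?d (N * n)" using Ub by simp
  have X: "X \<in> carrier_vec (N * n)" unfolding X_def by (rule mult_mat_vec_carrier[OF Ub v])
  have "?Ub\<^sup>T * ?Ub = diag_block_mat (map (\<lambda>i. (U i)\<^sup>T) [0..<N]) * ?Ub"
    by (simp add: diag_block_mat_transpose comp_def)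
  also have "\<dots> = diag_block_mat (map (\<lambda>i. (U i)\<^sup>T * U i) [0..<N])"
    by (rule diag_block_mat_mult[OF UTi Ui])
  also have "\<dots> = diag_block_mat (map (\<lambda>i. 1\<^sub>m (\<nu> i)) [0..<N])"
    using one by (intro arg_cong[of _ _ diag_block_mat] map_cong refl) simp
  also have "\<dots> = 1\<^sub>m ?d"
    using diag_block_one_mat[of "map (\<lambda>i. 1\<^sub>m (\<nu> i) :: real mat) [0..<N]"] by (simp add: comp_def sums)
  finally have UbTUb: "?Ub\<^sup>T * ?Ub = 1\<^sub>m ?d" .
  have "X \<bullet> X = (?Ub\<^sup>T *\<^sub>v X) \<bullet> v"
    unfolding X_def by (rule transpose_vec_mult_scalar[OF Ub v mult_mat_vec_carrier[OF Ub v], symmetric])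
  also have "?Ub\<^sup>T *\<^sub>v X = v"
    unfolding X_def using assoc_mult_mat_vec[OF UbT Ub v] UbTUb v by simp
  finally have "v \<bullet> v = X \<bullet> X" by simp
  also have "\<dots> = (\<Sum>r<N * n. (X $ r)\<^sup>2)"
    using X by (simp add: scalar_prod_def lessThan_atLeast0 power2_eq_square)
  also have "\<dots> = (\<Sum>i<N. \<Sum>a<n. (block_entry n X i a)\<^sup>2)"
    by (simp only: sum_blocks block_entry_def)
  finally show "(\<Sum>i<N. \<Sum>a<n. (block_entry n X i a)\<^sup>2) = v \<bullet> v" by (rule sym)
  show "(\<Sum>b<n. (U i * (U i)\<^sup>T) $$ (a, b) * block_entry n X i b) = block_entry n X i a"
    if ia: "i < N" "a < n"
  proof -
    let ?Pd = "diag_block_mat (map (\<lambda>i. U i * (U i)\<^sup>T) [0..<N])"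
    have Pd: "?Pd \<in> carrier_mat (N * n) (N * n)"
      unfolding sums[symmetric] by (rule diag_block_mat_carrier, rule Pi)
    have "?Pd * ?Ub = diag_block_mat (map (\<lambda>i. U i * (U i)\<^sup>T * U i) [0..<N])"
      by (rule diag_block_mat_mult[OF Pi Ui])
    also have "\<dots> = ?Ub"
      using orthonormal_projection_matrix(2)[OF U one]
      by (intro arg_cong[of _ _ diag_block_mat] map_cong refl) simp
    finally have "?Pd *\<^sub>v X = X"
      unfolding X_def using assoc_mult_mat_vec[OF Pd Ub v] by simp
    moreover have "(?Pd *\<^sub>v X) $ (i * n + a) = (\<Sum>b<n. (U i * (U i)\<^sup>T) $$ (a, b) * X $ (i * n + b))"
      by (rule diag_block_mat_mult_vec_index[OF _ X ia]) (use Pi in simp)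
    ultimately show ?thesis by (simp add: block_entry_def)
  qed
qed

theorem lemma3:
  fixes n N n0 :: nat
    and A :: "real mat"
    and m \<nu> :: "nat \<Rightarrow> nat"
    and C U :: "nat \<Rightarrow> real mat"
    and \<gamma> :: "nat \<Rightarrow> real"
    and G :: "nat \<Rightarrow> nat pair_pre_digraph"
    and W :: "nat \<Rightarrow> real mat"
    and \<tau> :: real
    and t :: "nat \<Rightarrow> real"
    and \<sigma> :: "real \<Rightarrow> nat"
  assumes A: "A \<in> carrier_mat n n" "transpose_mat A = - A"
    and C: "\<And>i. i < N \<Longrightarrow> C i \<in> carrier_mat (m i) n"
    and \<nu>: "\<And>i. i < N \<Longrightarrow> \<nu> i = kernel_dim (observability_mat (C i) A)"
    and U: "\<And>i. i < N \<Longrightarrow> U i \<in> carrier_mat n (\<nu> i)"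
      "\<And>i. i < N \<Longrightarrow> orthonormal_basis_cols (U i) (mat_kernel (observability_mat (C i) A))"
    and \<gamma>: "\<And>i. i < N \<Longrightarrow> \<gamma> i > 0"
    and graphs: "\<And>p. p \<in> {1..n0} \<Longrightarrow> undirected_graph_on N (G p)"
      "\<And>p. p \<in> {1..n0} \<Longrightarrow> weighted_adjacency N (G p) (W p)"
    and switching: "switching_signal n0 \<tau> t \<sigma>"
    and observable: "observable (stack_mat n (map C [0..<N])) A"
    and connected: "jointly_connected N G \<tau> t \<sigma>"
  shows "let Ub = diag_block_mat (map U [0..<N]);
             Ao = diag_block_mat (map (\<lambda>i. unobservable_part A (U i)) [0..<N]);
             \<Gamma> = diag_block_mat (map (\<lambda>i. \<gamma> i \<cdot>\<^sub>m 1\<^sub>m (\<nu> i)) [0..<N])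
         in exponentially_stable (\<Sum>i<N. \<nu> i)
              (\<lambda>s. Ao - \<Gamma> * transpose_mat Ub * kronecker (laplacian (W (\<sigma> s))) (1\<^sub>m n) * Ub)
              (range t)"
proof -
  let ?d = "\<Sum>i<N. \<nu> i"
  define Ub where "Ub = diag_block_mat (map U [0..<N])"
  define E where "E s = diag_block_mat (map (\<lambda>i. unobservable_part A (U i)) [0..<N])
    - diag_block_mat (map (\<lambda>i. \<gamma> i \<cdot>\<^sub>m 1\<^sub>m (\<nu> i)) [0..<N]) * Ub\<^sup>T
      * kronecker (laplacian (W (\<sigma> s))) (1\<^sub>m n) * Ub" for s
  let ?P = "\<lambda>i a b. (U i * (U i)\<^sup>T) $$ (a, b)"
  note basis = U(2)
  have one: "(U i)\<^sup>T * U i = 1\<^sub>m (\<nu> i)" if "i < N" for i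
    using basis[OF that] U(1)[OF that] by (simp add: orthonormal_basis_cols_def)
  have inv: "U i * unobservable_part A (U i) = A * U i" if "i < N" for i
    by (rule invariant_subspace_projection[OF A(1) U(1)[OF that] basis[OF that]
          unobservable_subspace_invariant[OF A(1) C[OF that]]])
  have P: "U i * (U i)\<^sup>T \<in> carrier_mat n n" if "i < N" for i
    using U(1)[OF that] by simp
  have symP: "?P i b a = ?P i a b" if "i < N" "a < n" "b < n" for i a b
  proof -
    have "(U i * (U i)\<^sup>T)\<^sup>T $$ (a, b) = ?P i b a"
      using P[OF that(1)] that by (intro index_transpose_mat(1)) auto
    then show ?thesis using orthonormal_projection_matrix(1)[OF U(1) one] that by simp
  qed
  have skew: "A $$ (b, a) = - (A $$ (a, b))" if "a < n" "b < n" for a b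
  proof -
    have "A\<^sup>T $$ (a, b) = A $$ (b, a)" using A(1) that by (intro index_transpose_mat(1)) auto
    then show ?thesis using A that by simp
  qed
  have proj: "(\<Sum>a<n. ?P i a b * ?P i a c) = ?P i b c" if i: "i < N" and bc: "b < n" "c < n" for i b c
  proof -
    let ?R = "U i * (U i)\<^sup>T"
    have R: "?R \<in> carrier_mat n n" by (rule P[OF i])
    have "(\<Sum>a<n. ?P i a b * ?P i a c) = (\<Sum>a<n. ?P i b a * ?P i a c)"
      by (intro sum.cong refl arg_cong2[of _ _ _ _ "(*)"] symP i bc) simp
    also have "\<dots> = (?R * ?R) $$ (b, c)"
      by (rule mat_mult_index_sum[OF R R bc, symmetric])
    also have "\<dots> = ?P i b c" by (simp only: orthonormal_projection_matrix(3)[OF U(1)[OF i] one[OF i]])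
    finally show ?thesis .
  qed
  (* A vector fixed by every projection is unobservable at every node, hence unobservable for the stacked
     output, hence 0. *)
  have triv: "\<forall>a<n. y a = 0" if fixed: "\<forall>i<N. \<forall>a<n. (\<Sum>b<n. ?P i a b * y b) = y a" for y
  proof -
    define v where "v = vec n y"
    have v: "v \<in> carrier_vec n" by (simp add: v_def)
    have unobservable: "v \<in> mat_kernel (observability_mat (C i) A)" if i: "i < N" for i
    proof -
      have UT: "(U i)\<^sup>T \<in> carrier_mat (\<nu> i) n" using U(1)[OF i] by simp
      have "(U i * (U i)\<^sup>T) *\<^sub>v v = v"
      proof (rule eq_vecI)
        fix a assume "a < dim_vec v"
        then have a: "a < n" by (simp add: v_def)
        have "((U i * (U i)\<^sup>T) *\<^sub>v v) $ a = (\<Sum>b<n. ?P i a b * y b)"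
          unfolding mult_mat_vec_index_sum[OF P[OF i] v a] by (intro sum.cong refl) (simp add: v_def)
        then show "((U i * (U i)\<^sup>T) *\<^sub>v v) $ a = v $ a" using fixed i a by (simp add: v_def)
      qed (use U(1)[OF i] in \<open>simp add: v_def\<close>)
      then have "v = U i *\<^sub>v ((U i)\<^sup>T *\<^sub>v v)"
        using assoc_mult_mat_vec[OF U(1)[OF i] UT v] by simp
      then show ?thesis
        unfolding orthonormal_basis_cols_image[OF U(1)[OF i] basis[OF i]]
        using mult_mat_vec_carrier[OF UT v] by blast
    qed
    have "v = 0\<^sub>v n"
      by (rule common_unobservable_subspace_trivial[OF A(1) C observable v unobservable])
    then have "v $ a = 0" if "a < n" for a using that by simp
    then show ?thesis by (simp add: v_def)
  qed
  have W: "W p \<in> carrier_mat N N" "(W p)\<^sup>T = W p" "\<And>i. i < N \<Longrightarrow> W p $$ (i, i) = 0"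
    "\<And>i j. i < N \<Longrightarrow> j < N \<Longrightarrow> i \<noteq> j \<Longrightarrow>
      (if (j, i) \<in> parcs (G p) then W p $$ (i, j) > 0 else W p $$ (i, j) = 0)"
    if "p \<in> {1..n0}" for p
    using graphs(2)[OF that] unfolding weighted_adjacency_def by blast+
  have W_sym: "W p $$ (i, j) = W p $$ (j, i)" if "p \<in> {1..n0}" "i < N" "j < N" for p i j
  proof -
    have "(W p)\<^sup>T $$ (i, j) = W p $$ (j, i)"
      using W(1)[OF that(1)] that by (intro index_transpose_mat(1)) auto
    then show ?thesis using W(2)[OF that(1)] by simp
  qed
  have W_nonneg: "0 \<le> W p $$ (i, j)" if "p \<in> {1..n0}" "i < N" "j < N" for p i j
    using W(3)[OF that(1,2)] W(4)[OF that] by (cases "i = j") (auto split: if_splits)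
  have arcs: "i < N \<and> j < N" if "p \<in> {1..n0}" "(i, j) \<in> parcs (G p)" for p i j
  proof -
    have G: "pair_pseudo_graph (G p)" "pverts (G p) = {0..<N}"
      using graphs(1)[OF that(1)] by (auto simp: undirected_graph_on_def)
    interpret pair_pseudo_graph "G p" by (rule G(1))
    show ?thesis using in_arcsD1[OF that(2)] in_arcsD2[OF that(2)] G(2) by simp
  qed
  have W_pos: "0 < W p $$ (i, j)" if "p \<in> {1..n0}" "(i, j) \<in> parcs (G p)" "i \<noteq> j" for p i j
    using W(4)[OF that(1), of j i] W_sym[OF that(1), of i j] arcs[OF that(1,2)] that by simp
  have "\<exists>c>0. \<exists>l>0. \<forall>x. node_trajectory n N (\<lambda>a b. A $$ (a, b)) ?P \<gamma> (\<lambda>s i j. W (\<sigma> s) $$ (i, j)) (range t) x \<longrightarrow>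
    (\<forall>r\<ge>0. \<forall>s\<ge>r.
      (\<Sum>i<N. \<Sum>a<n. (x s i a)\<^sup>2) \<le> c * exp (- l * (s - r)) * (\<Sum>i<N. \<Sum>a<n. (x r i a)\<^sup>2))"
    by (rule projected_consensus_decay[where w = "\<lambda>p i j. W p $$ (i, j)",
          OF skew proj symP triv \<gamma> W_sym W_nonneg arcs W_pos switching connected])
  then obtain c l where cl: "0 < c" "0 < l"
    "\<And>x r s. node_trajectory n N (\<lambda>a b. A $$ (a, b)) ?P \<gamma> (\<lambda>s i j. W (\<sigma> s) $$ (i, j)) (range t) x \<Longrightarrow>
      0 \<le> r \<Longrightarrow> r \<le> s \<Longrightarrow>
      (\<Sum>i<N. \<Sum>a<n. (x s i a)\<^sup>2) \<le> c * exp (- l * (s - r)) * (\<Sum>i<N. \<Sum>a<n. (x r i a)\<^sup>2)"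
    by blast
  have gain: "0 < sqrt c" and rate: "0 < l / 2" using cl by auto
  have "exponentially_stable ?d E (range t)"
    unfolding exponentially_stable_def
  proof (rule exI, rule conjI[OF gain], rule exI, rule conjI[OF rate], intro allI impI)
    fix z :: "real \<Rightarrow> real vec" and r s :: real
    assume sol: "ltv_solution ?d E (range t) z" and rs: "0 \<le> r" "r \<le> s"
    have z: "z s \<in> carrier_vec ?d" if "0 \<le> s" for s
      using sol that by (simp add: ltv_solution_def)
    (* For negative times z s is an arbitrary vector, possibly of another dimension; rebuilding it with
       the right dimension makes the formula for the coordinates valid at all times. *)
    define x where "x s = block_entry n (Ub *\<^sub>v vec ?d (vec_index (z s)))" for s
    have x: "x s = block_entry n (Ub *\<^sub>v z s)" if "0 \<le> s" for s
      unfolding x_def using z[OF that] by (metis carrier_vecD eq_vecI dim_vec index_vec)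
    have sums: "(\<Sum>i\<leftarrow>[0..<N]. \<nu> i) = ?d" "(\<Sum>i\<leftarrow>[0..<N]. n) = N * n"
      by (simp_all add: interv_sum_list_conv_sum_set_nat lessThan_atLeast0 sum_list_triv)
    have Ub: "Ub \<in> carrier_mat (N * n) ?d"
      unfolding Ub_def sums[symmetric] by (rule diag_block_mat_carrier) (use U(1) in simp)
    have entry: "block_entry n (Ub *\<^sub>v v) i a = (\<Sum>k<?d. Ub $$ (i * n + a, k) * v $ k)"
      if "v \<in> carrier_vec ?d" "i < N" "a < n" for v i a
      unfolding block_entry_def by (rule mult_mat_vec_index_sum[OF Ub that(1) block_index_less[OF that(2,3)]])
    have x_sum: "x s i a = (\<Sum>k<?d. Ub $$ (i * n + a, k) * z s $ k)" if "i < N" "a < n" for s i a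
      unfolding x_def by (subst entry[OF _ that]) auto
    have norm: "euclidean_norm (z s) = sqrt (\<Sum>i<N. \<Sum>a<n. (x s i a)\<^sup>2)" if "0 \<le> s" for s
      unfolding euclidean_norm_def x[OF that] Ub_def
      by (simp only: block_diagonal_isometry_norm[OF U(1) one z[OF that]])
    have "node_trajectory n N (\<lambda>a b. A $$ (a, b)) ?P \<gamma> (\<lambda>s i j. W (\<sigma> s) $$ (i, j)) (range t) x"
      unfolding node_trajectory_def
    proof (intro conjI allI impI)
      fix i a assume ia: "i < N" "a < n"
      have "continuous_on {0..} (\<lambda>s. z s $ k)" if "k < ?d" for k
        using sol that by (simp add: ltv_solution_def)
      then show "continuous_on {0..} (\<lambda>s. x s i a)"
        unfolding x_sum[OF ia] by (intro continuous_intros) auto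
    next
      fix s i a assume s: "0 < s" "s \<notin> range t" and ia: "i < N" "a < n"
      have p: "\<sigma> s \<in> {1..n0}" using switching s by (simp add: switching_signal_def)
      have Es: "E s \<in> carrier_mat ?d ?d"
        unfolding E_def
        by (rule carrier_matI) (simp_all add: dim_diag_block_mat comp_def sums carrier_matD(2)[OF Ub])
      have Ez: "E s *\<^sub>v z s \<in> carrier_vec ?d" by (rule mult_mat_vec_carrier[OF Es z]) (use s in simp)
      have "((\<lambda>r. z r $ k) has_real_derivative (E s *\<^sub>v z s) $ k) (at s)" if "k < ?d" for k
      proof -
        have "((\<lambda>r. z r $ k) has_real_derivative (E s *\<^sub>v z s) $ k) (at s within {0..})"
          using sol s that by (simp add: ltv_solution_def)
        (* As s is an interior point of the time axis, the derivative within it is a full derivative. *)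
        then have "((\<lambda>r. z r $ k) has_real_derivative (E s *\<^sub>v z s) $ k) (at s within {0<..})"
          by (rule DERIV_subset) auto
        then show ?thesis using s by (simp add: at_within_open[of s "{0<..}"])
      qed
      then have "((\<lambda>r. x r i a) has_real_derivative
          (\<Sum>k<?d. Ub $$ (i * n + a, k) * (E s *\<^sub>v z s) $ k)) (at s)"
        unfolding x_sum[OF ia] by (intro DERIV_sum DERIV_cmult) auto
      also have "(\<Sum>k<?d. Ub $$ (i * n + a, k) * (E s *\<^sub>v z s) $ k) = block_entry n (Ub *\<^sub>v (E s *\<^sub>v z s)) i a"
        by (rule entry[OF Ez ia, symmetric])
      also have "\<dots> = (\<Sum>b<n. A $$ (a, b) * x s i b)
          - coupling n N ?P \<gamma> (\<lambda>i j. W (\<sigma> s) $$ (i, j)) (x s) i a"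
        unfolding x[OF order_less_imp_le[OF s(1)]] E_def Ub_def
        by (rule network_matrix_in_node_coordinates[OF A(1) U(1) inv W(1)[OF p] W(3)[OF p] _ ia])
          (use z s in auto)
      finally show "((\<lambda>r. x r i a) has_real_derivative (\<Sum>b<n. A $$ (a, b) * x s i b)
          - coupling n N ?P \<gamma> (\<lambda>i j. W (\<sigma> s) $$ (i, j)) (x s) i a) (at s)" .
    next
      fix s :: real and i a assume "0 \<le> s" "i < N" "a < n"
      then show "(\<Sum>b<n. ?P i a b * x s i b) = x s i a"
        unfolding x[OF \<open>0 \<le> s\<close>] Ub_def by (intro block_diagonal_isometry_range[OF U(1) one z])
    qed
    from cl(3)[OF this rs]
    have "euclidean_norm (z s) \<le> sqrt (c * exp (- l * (s - r)) * (\<Sum>i<N. \<Sum>a<n. (x r i a)\<^sup>2))"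
      using norm[of s] rs by simp
    also have "\<dots> = sqrt c * sqrt (exp (- l * (s - r))) * euclidean_norm (z r)"
      using norm[OF rs(1)] by (simp add: real_sqrt_mult)
    also have "sqrt (exp (- l * (s - r))) = exp (- (l / 2) * (s - r))"
      by (rule real_sqrt_unique) (simp_all add: power2_eq_square mult_exp_exp algebra_simps)
    finally show "euclidean_norm (z s) \<le> sqrt c * exp (- (l / 2) * (s - r)) * euclidean_norm (z r)" .
  qed
  then show ?thesis unfolding Let_def Ub_def E_def .
qed

end
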